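(* Let $\varphi$ be an automorphism of the unit disk $D$. Then the composition operator $C_\varphi$ is complex symmetric on $H^2(D)$ if and only if $\varphi$ is either a rotation or an involutive automorphism.
   Context: $D$ is the open unit disk in $\mathbb{C}$; an automorphism of $D$ is a biholomorphic map of $D$ onto itself. $H^2(D)$ is the Hardy space of analytic functions $f$ on $D$ with $\|f\|^2=\sup_{0<r<1}\int_0^{2\pi}|f(re^{i\theta})|^2\frac{d\theta}{2\pi}<\infty$, a Hilbert space. For an analytic self-map $\varphi$ of $D$, $C_\varphi f=f\circ\varphi$ is a bounded operator on $H^2(D)$. A conjugation on a complex Hilbert space $\mathcal{H}$ is a map $C:\mathcal{H}\to\mathcal{H}$ that is conjugate-linear, satisfies $\langle Cx,Cy\rangle=\langle y,x\rangle$ for all $x,y\in\mathcal{H}$, and satisfies $C^2=I$. A bounded operator $T$ on $\mathcal{H}$ is complex symmetric if there exists a conjugation $C$ on $\mathcal{H}$ with $T=CT^*C$. A rotation is a map $z\mapsto sz$ with $|s|=1$. An automorphism $\varphi$ of $D$ is involutive if $\varphi\circ\varphi$ is the identity on $D$. *)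

theory Defs
  imports "HOL-Complex_Analysis.Complex_Analysis" "HOL-Library.Function_Algebras"
begin

text \<open>
  A complex inner product space is given by a carrier \<open>H\<close> in an additive group, a scalar
  multiplication \<open>sc\<close> and an inner product \<open>ip\<close>, linear in its first argument.
\<close>

definition ip_norm :: "('a \<Rightarrow> 'a \<Rightarrow> complex) \<Rightarrow> 'a \<Rightarrow> real" where
  "ip_norm ip x = sqrt (Re (ip x x))"

definition bounded_operator ::
  "('a::ab_group_add) set \<Rightarrow> (complex \<Rightarrow> 'a \<Rightarrow> 'a) \<Rightarrow> ('a \<Rightarrow> 'a \<Rightarrow> complex) \<Rightarrow> ('a \<Rightarrow> 'a) \<Rightarrow> bool"
  where
  "bounded_operator H sc ip T \<longleftrightarrow>
     T ` H \<subseteq> H \<and>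
     (\<forall>x\<in>H. \<forall>y\<in>H. T (x + y) = T x + T y) \<and>
     (\<forall>c. \<forall>x\<in>H. T (sc c x) = sc c (T x)) \<and>
     (\<exists>K. \<forall>x\<in>H. ip_norm ip (T x) \<le> K * ip_norm ip x)"

definition is_adjoint ::
  "('a::ab_group_add) set \<Rightarrow> ('a \<Rightarrow> 'a \<Rightarrow> complex) \<Rightarrow> ('a \<Rightarrow> 'a) \<Rightarrow> ('a \<Rightarrow> 'a) \<Rightarrow> bool"
  where
  "is_adjoint H ip T S \<longleftrightarrow> S ` H \<subseteq> H \<and> (\<forall>x\<in>H. \<forall>y\<in>H. ip (T x) y = ip x (S y))"

definition conjugation ::
  "('a::ab_group_add) set \<Rightarrow> (complex \<Rightarrow> 'a \<Rightarrow> 'a) \<Rightarrow> ('a \<Rightarrow> 'a \<Rightarrow> complex) \<Rightarrow> ('a \<Rightarrow> 'a) \<Rightarrow> bool"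
  where
  "conjugation H sc ip C \<longleftrightarrow>
     C ` H \<subseteq> H \<and>
     (\<forall>x\<in>H. \<forall>y\<in>H. C (x + y) = C x + C y) \<and>
     (\<forall>c. \<forall>x\<in>H. C (sc c x) = sc (cnj c) (C x)) \<and>
     (\<forall>x\<in>H. \<forall>y\<in>H. ip (C x) (C y) = ip y x) \<and>
     (\<forall>x\<in>H. C (C x) = x)"

text \<open>
  On a Hilbert space the adjoint \<open>S\<close> of a bounded \<open>T\<close> exists and is unique on \<open>H\<close>, so
  quantifying \<open>S\<close> existentially merely names \<open>T\<^sup>*\<close>.
\<close>

definition complex_symmetric ::
  "('a::ab_group_add) set \<Rightarrow> (complex \<Rightarrow> 'a \<Rightarrow> 'a) \<Rightarrow> ('a \<Rightarrow> 'a \<Rightarrow> complex) \<Rightarrow> ('a \<Rightarrow> 'a) \<Rightarrow> bool"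
  where
  "complex_symmetric H sc ip T \<longleftrightarrow>
     bounded_operator H sc ip T \<and>
     (\<exists>C S. conjugation H sc ip C \<and> is_adjoint H ip T S \<and> (\<forall>x\<in>H. T x = C (S (C x))))"

abbreviation unit_disk :: "complex set" where
  "unit_disk \<equiv> ball 0 1"

definition hardy_mean :: "(complex \<Rightarrow> complex) \<Rightarrow> real \<Rightarrow> real" where
  "hardy_mean f r =
     integral {0..2 * pi} (\<lambda>t. (cmod (f (complex_of_real r * cis t)))\<^sup>2) / (2 * pi)"

text \<open>
  Functions on the disk are represented by total functions that vanish off the disk, so that
  equality in \<open>hardy_space\<close> is equality on the disk.
\<close>

definition hardy_space :: "(complex \<Rightarrow> complex) set" where
  "hardy_space =
     {f. f holomorphic_on unit_disk \<and> (\<forall>z. z \<notin> unit_disk \<longrightarrow> f z = 0) \<and>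
         bdd_above (hardy_mean f ` {0<..<1})}"

definition hardy_norm :: "(complex \<Rightarrow> complex) \<Rightarrow> real" where
  "hardy_norm f = sqrt (SUP r\<in>{0<..<1}. hardy_mean f r)"

definition fun_scale :: "complex \<Rightarrow> (complex \<Rightarrow> complex) \<Rightarrow> complex \<Rightarrow> complex" where
  "fun_scale c f = (\<lambda>z. c * f z)"

text \<open>The inner product that induces \<open>hardy_norm\<close>, recovered by polarization.\<close>

definition hardy_inner :: "(complex \<Rightarrow> complex) \<Rightarrow> (complex \<Rightarrow> complex) \<Rightarrow> complex" where
  "hardy_inner f g =
     (\<Sum>k<4. \<i> ^ k * of_real ((hardy_norm (f + fun_scale (\<i> ^ k) g))\<^sup>2)) / 4"

lemma hardy_mean_scale: "hardy_mean (fun_scale c f) r = (cmod c)\<^sup>2 * hardy_mean f r"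
  by (simp add: hardy_mean_def fun_scale_def norm_mult power_mult_distrib)

lemma hardy_norm_nonneg:
  assumes "f \<in> hardy_space"
  shows "hardy_norm f \<ge> 0"
proof -
  have "0 \<le> hardy_mean f (1/2)"
    unfolding hardy_mean_def
    by (cases "(\<lambda>t. (cmod (f (complex_of_real (1/2) * cis t)))\<^sup>2) integrable_on {0..2 * pi}")
       (auto intro!: divide_nonneg_pos integral_nonneg simp: not_integrable_integral)
  also have "\<dots> \<le> (SUP r\<in>{0<..<1}. hardy_mean f r)"
    using assms by (intro cSUP_upper) (auto simp: hardy_space_def)
  finally show ?thesis by (simp add: hardy_norm_def)
qed

lemma hardy_norm_scale:
  assumes "f \<in> hardy_space"
  shows "hardy_norm (fun_scale c f) = cmod c * hardy_norm f"
proof -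
  have bdd: "bdd_above (hardy_mean f ` {0<..<1})"
    using assms by (simp add: hardy_space_def)
  have ne: "hardy_mean f ` {0<..<1::real} \<noteq> {}"
    by simp
  have "(cmod c)\<^sup>2 * Sup (hardy_mean f ` {0<..<1})
      = (SUP s\<in>hardy_mean f ` {0<..<1}. (cmod c)\<^sup>2 * s)"
    by (rule continuous_at_Sup_mono[OF _ _ ne bdd])
       (auto intro!: monoI mult_left_mono continuous_intros)
  also have "\<dots> = (SUP r\<in>{0<..<1}. hardy_mean (fun_scale c f) r)"
    by (simp add: image_image hardy_mean_scale)
  finally show ?thesis
    unfolding hardy_norm_def by (metis norm_ge_zero real_sqrt_mult real_sqrt_unique)
qed

lemma hardy_norm_inner:
  assumes "f \<in> hardy_space"
  shows "ip_norm hardy_inner f = hardy_norm f"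
proof -
  have eq: "f + fun_scale a f = fun_scale (1 + a) f" for a
    by (auto simp: fun_scale_def algebra_simps)
  have n: "(hardy_norm (f + fun_scale a f))\<^sup>2 = (cmod (1 + a))\<^sup>2 * (hardy_norm f)\<^sup>2" for a
    by (simp add: eq hardy_norm_scale[OF assms] power_mult_distrib)
  have "hardy_inner f f = of_real ((hardy_norm f)\<^sup>2)"
    unfolding hardy_inner_def n
    by (simp add: numeral_eq_Suc cmod_power2 of_real_power[symmetric] complex_eq_iff
        del: of_real_power) (simp add: cmod_def real_sqrt_pow2 algebra_simps)
  then show ?thesis
    using hardy_norm_nonneg[OF assms] by (simp add: ip_norm_def)
qed

definition composition_operator ::
  "(complex \<Rightarrow> complex) \<Rightarrow> (complex \<Rightarrow> complex) \<Rightarrow> complex \<Rightarrow> complex" where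
  "composition_operator \<phi> f = (\<lambda>z. if z \<in> unit_disk then f (\<phi> z) else 0)"

definition disk_automorphism :: "(complex \<Rightarrow> complex) \<Rightarrow> bool" where
  "disk_automorphism \<phi> \<longleftrightarrow>
     \<phi> holomorphic_on unit_disk \<and> bij_betw \<phi> unit_disk unit_disk \<and>
     inv_into unit_disk \<phi> holomorphic_on unit_disk"

definition is_rotation :: "(complex \<Rightarrow> complex) \<Rightarrow> bool" where
  "is_rotation \<phi> \<longleftrightarrow> (\<exists>s. cmod s = 1 \<and> (\<forall>z\<in>unit_disk. \<phi> z = s * z))"

definition involutive_automorphism :: "(complex \<Rightarrow> complex) \<Rightarrow> bool" where
  "involutive_automorphism \<phi> \<longleftrightarrow> disk_automorphism \<phi> \<and> (\<forall>z\<in>unit_disk. \<phi> (\<phi> z) = z)"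

end

theory Submission
  imports Defs
begin

text \<open>
  Taylor coefficients identify the Hardy space with the square-summable sequences. If
  \<open>\<phi> = u * mob b\<close> with \<open>mob b z = (b - z) / (1 - cnj b z)\<close>, then \<open>C\<^sub>\<phi>\<close> is a dilation
  followed by \<open>W = C\<^bsub>mob b\<^esub>\<close>, and \<open>W\<close> is \<open>1 - cnj b S\<close> (\<open>S\<close> the shift) applied after a
  unitary involution, up to a factor; this gives boundedness and an explicit adjoint.

  Rotations are diagonal. For the involution \<open>W\<close>, the sign \<open>N\<close> of the self-adjoint operator
  \<open>W + W\<^sup>*\<close> satisfies \<open>N W\<^sup>* N = W\<close>, and composing \<open>N\<close> with a conjugation commuting with
  \<open>W\<close> gives the required conjugation.

  Conversely let \<open>C\<close> be a conjugation with \<open>T = C T\<^sup>* C\<close> for \<open>T = C\<^sub>\<phi>\<close>. If the orbit of 0 is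
  not contained in a smaller disk, then \<open>g = C 1\<close> is fixed by \<open>T\<^sup>*\<close>; since the iterates
  \<open>\<phi>\<^sub>n\<^sup>m\<close> come arbitrarily close in norm to unimodular constants, all Taylor coefficients of
  \<open>g\<close> have the same modulus, so \<open>g = 0\<close>, a contradiction. Otherwise \<open>\<phi>\<close> fixes some \<open>a\<close> in
  the disk, and unless \<open>a = 0\<close> or \<open>\<phi>\<close> is involutive, the angles between the eigenspaces of
  \<open>T\<close> and of \<open>T\<^sup>*\<close> do not match.
\<close>

section \<open>The Hilbert space of square-summable sequences\<close>

text \<open>The sign of \<open>L\<close>, the sum of \<open>W\<close> and its adjoint, is a
  norm-convergent binomial series. This works because \<open>W\<close> is an involution: the cross
  terms in the square of \<open>norm (L x)\<close> add up to twice the square of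
  \<open>norm x\<close>, so the square of \<open>L\<close> is bounded below by 2, and after scaling
  it differs from the identity by a strict contraction. A power series in a self-adjoint
  \<open>X\<close> commutes with every bounded real-linear map that commutes with \<open>X\<close>,
  conjugate-linear maps included; hence the sign commutes with a suitable conjugation.

  In the converse, parabolic and hyperbolic automorphisms share one argument: the entries of the
  matrix powers grow at least linearly. The elliptic case is shaped by roots of unity. If the
  multiplier \<open>l\<close> has finite order, the eigenspaces are infinite-dimensional, so no
  distinguished eigenvectors are available and angles between whole eigenspaces are compared. Only
  the eigenvalues belonging to 1, \<open>l\<close> and the square of \<open>l\<close> occur; these
  are distinct as soon as the square of \<open>l\<close> is not 1.\<close>

typedef ell2 = "{a :: nat \<Rightarrow> complex. summable (\<lambda>n. (cmod (a n))\<^sup>2)}"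
  morphisms coord Ell2
  by (rule exI[of _ "\<lambda>_. 0"]) simp

setup_lifting type_definition_ell2

lemma summable_coord: "summable (\<lambda>n. (cmod (coord x n))\<^sup>2)"
  using coord[of x] by simp

lemma ell2_eqI: "(\<And>n. coord x n = coord y n) \<Longrightarrow> x = y"
  by (metis coord_inject ext)

lemma coord_Ell2: "summable (\<lambda>n. (cmod (a n))\<^sup>2) \<Longrightarrow> coord (Ell2 a) = a"
  by (simp add: Ell2_inverse)

lemma summable_sq_add:
  fixes a b :: "nat \<Rightarrow> complex"
  assumes "summable (\<lambda>n. (cmod (a n))\<^sup>2)" "summable (\<lambda>n. (cmod (b n))\<^sup>2)"
  shows "summable (\<lambda>n. (cmod (a n + b n))\<^sup>2)"
proof (rule summable_comparison_test')
  show "summable (\<lambda>n. 2 * (cmod (a n))\<^sup>2 + 2 * (cmod (b n))\<^sup>2)"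
    by (intro summable_add summable_mult assms)
  fix n
  have "(cmod (a n + b n))\<^sup>2 \<le> (cmod (a n) + cmod (b n))\<^sup>2"
    by (intro power_mono norm_triangle_ineq) auto
  also have "\<dots> \<le> 2 * (cmod (a n))\<^sup>2 + 2 * (cmod (b n))\<^sup>2"
    using sum_squares_bound[of "cmod (a n)" "cmod (b n)"] by (simp add: power2_sum)
  finally show "norm ((cmod (a n + b n))\<^sup>2) \<le> 2 * (cmod (a n))\<^sup>2 + 2 * (cmod (b n))\<^sup>2"
    by simp
qed

lemma summable_sq_mult:
  fixes a :: "nat \<Rightarrow> complex"
  assumes "summable (\<lambda>n. (cmod (a n))\<^sup>2)"
  shows "summable (\<lambda>n. (cmod (c * a n))\<^sup>2)"
  using summable_mult[OF assms, of "(cmod c)\<^sup>2"] by (simp add: norm_mult power_mult_distrib)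

lift_definition csc :: "complex \<Rightarrow> ell2 \<Rightarrow> ell2" is "\<lambda>c a n. c * a n"
  by (rule summable_sq_mult)

definition ip :: "ell2 \<Rightarrow> ell2 \<Rightarrow> complex" where
  "ip x y = (\<Sum>n. coord x n * cnj (coord y n))"

lemma summable_ip_norm: "summable (\<lambda>n. norm (coord x n * cnj (coord y n)))"
proof (rule summable_comparison_test')
  show "summable (\<lambda>n. (cmod (coord x n))\<^sup>2 + (cmod (coord y n))\<^sup>2)"
    by (intro summable_add summable_coord)
  fix n
  have "cmod (coord x n) * cmod (coord y n) \<ge> 0" by simp
  then show "norm (norm (coord x n * cnj (coord y n))) \<le> (cmod (coord x n))\<^sup>2 + (cmod (coord y n))\<^sup>2"
    using sum_squares_bound[of "cmod (coord x n)" "cmod (coord y n)"]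
    by (simp add: norm_mult del: mult_nonneg_nonneg)
qed

lemma summable_ip: "summable (\<lambda>n. coord x n * cnj (coord y n))"
  using summable_ip_norm by (rule summable_norm_cancel)

text \<open>The class supplies norm, limits and Cauchy-Schwarz for the real part of
  \<open>ip\<close>. Complex scalars stay outside it, in \<open>csc\<close>, so complex linearity is
  always a separate claim and conjugate-linear maps still count as
  \<open>bounded_linear\<close>.\<close>

instantiation ell2 :: real_inner
begin

lift_definition zero_ell2 :: ell2 is "\<lambda>_. 0" by simp
lift_definition plus_ell2 :: "ell2 \<Rightarrow> ell2 \<Rightarrow> ell2" is "\<lambda>a b n. a n + b n"
  by (rule summable_sq_add)
lift_definition uminus_ell2 :: "ell2 \<Rightarrow> ell2" is "\<lambda>a n. - a n" by simp
lift_definition minus_ell2 :: "ell2 \<Rightarrow> ell2 \<Rightarrow> ell2" is "\<lambda>a b n. a n - b n"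
  using summable_sq_add[of _ "\<lambda>n. - _ n"] by simp
lift_definition scaleR_ell2 :: "real \<Rightarrow> ell2 \<Rightarrow> ell2" is "\<lambda>r a n. of_real r * a n"
  by (rule summable_sq_mult)
definition inner_ell2 :: "ell2 \<Rightarrow> ell2 \<Rightarrow> real" where "inner_ell2 x y = Re (ip x y)"
definition norm_ell2 :: "ell2 \<Rightarrow> real" where "norm_ell2 x = sqrt (inner x x)"
definition sgn_ell2 :: "ell2 \<Rightarrow> ell2" where "sgn_ell2 x = scaleR (inverse (norm x)) x"
definition dist_ell2 :: "ell2 \<Rightarrow> ell2 \<Rightarrow> real" where "dist_ell2 x y = norm (x - y)"
definition uniformity_ell2 :: "(ell2 \<times> ell2) filter" where
  "uniformity_ell2 = (INF e\<in>{0<..}. principal {(x, y). dist x y < e})"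
definition open_ell2 :: "ell2 set \<Rightarrow> bool" where
  "open_ell2 U = (\<forall>x\<in>U. \<forall>\<^sub>F (x', y) in uniformity. x' = x \<longrightarrow> y \<in> U)"

instance
proof
  show "inner x y = inner y x" for x y :: ell2
  proof -
    have "cnj (ip x y) = ip y x"
      unfolding ip_def using bounded_linear.suminf[OF bounded_linear_cnj summable_ip[of x y]]
      by (simp add: mult.commute)
    then show ?thesis unfolding inner_ell2_def by (metis complex_cnj(1) complex_cnj_cnj cnj.simps(1))
  qed
  show "inner (x + y) z = inner x z + inner y z" for x y z :: ell2
  proof -
    have "ip (x + y) z = ip x z + ip y z"
      unfolding ip_def plus_ell2.rep_eq
      using suminf_add[OF summable_ip[of x z] summable_ip[of y z]] by (simp add: algebra_simps)
    then show ?thesis by (simp add: inner_ell2_def)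
  qed
  show "inner (scaleR r x) y = r * inner x y" for r and x y :: ell2
  proof -
    have "ip (scaleR r x) y = of_real r * ip x y"
      unfolding ip_def scaleR_ell2.rep_eq
      using suminf_mult[OF summable_ip[of x y], of "of_real r"] by (simp add: algebra_simps)
    then show ?thesis by (simp add: inner_ell2_def)
  qed
  have sq: "inner x x = (\<Sum>n. (cmod (coord x n))\<^sup>2)" for x :: ell2
  proof -
    have "ip x x = (\<Sum>n. of_real ((cmod (coord x n))\<^sup>2))"
      unfolding ip_def by (simp add: complex_mult_cnj cmod_power2)
    then show ?thesis
      unfolding inner_ell2_def by (metis Re_complex_of_real suminf_of_real summable_coord)
  qed
  show "0 \<le> inner x x" for x :: ell2
    unfolding sq by (intro suminf_nonneg summable_coord) simp
  show "(inner x x = 0) = (x = 0)" for x :: ell2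
    unfolding sq by (subst suminf_eq_zero_iff[OF summable_coord])
      (auto simp: zero_ell2.rep_eq intro: ell2_eqI)
qed (rule sgn_ell2_def dist_ell2_def norm_ell2_def uniformity_ell2_def open_ell2_def |
     (rule ell2_eqI, simp add: plus_ell2.rep_eq minus_ell2.rep_eq uminus_ell2.rep_eq
       zero_ell2.rep_eq scaleR_ell2.rep_eq algebra_simps))+

end

lemmas coord_simps [simp] = plus_ell2.rep_eq minus_ell2.rep_eq uminus_ell2.rep_eq
  zero_ell2.rep_eq scaleR_ell2.rep_eq csc.rep_eq

lemma inner_eq_Re_ip: "inner x y = Re (ip x y)"
  by (rule inner_ell2_def)

lemma cnj_ip: "cnj (ip x y) = ip y x"
  unfolding ip_def using bounded_linear.suminf[OF bounded_linear_cnj summable_ip[of x y]]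
  by (simp add: mult.commute)

lemma ip_add_left: "ip (x + y) z = ip x z + ip y z"
  unfolding ip_def using suminf_add[OF summable_ip[of x z] summable_ip[of y z]]
  by (simp add: algebra_simps)

lemma ip_csc_left: "ip (csc c x) y = c * ip x y"
  unfolding ip_def using suminf_mult[OF summable_ip[of x y], of c] by (simp add: algebra_simps)

lemma ip_add_right: "ip x (y + z) = ip x y + ip x z"
  by (metis cnj_ip complex_cnj_add ip_add_left)

lemma ip_csc_right: "ip x (csc c y) = cnj c * ip x y"
  by (metis cnj_ip complex_cnj_mult ip_csc_left)

lemma csc_minus1: "csc (- 1) x = - x"
  by (rule ell2_eqI) simp

lemma csc_of_real: "csc (of_real r) x = r *\<^sub>R x"
  by (rule ell2_eqI) simp



lemma ip_minus_left: "ip (- x) y = - ip x y"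
  by (metis csc_minus1 ip_csc_left mult_minus1)

lemma ip_minus_right: "ip x (- y) = - ip x y"
  by (metis cnj_ip complex_cnj_minus ip_minus_left)

lemma ip_diff_left: "ip (x - y) z = ip x z - ip y z"
  using ip_add_left[of x "- y" z] by (simp add: ip_minus_left)

lemma ip_diff_right: "ip x (y - z) = ip x y - ip x z"
  using ip_add_right[of x y "- z"] by (simp add: ip_minus_right)

lemma ip_zero_left [simp]: "ip 0 y = 0"
  by (simp add: ip_def)

lemma ip_zero_right [simp]: "ip x 0 = 0"
  by (simp add: ip_def)

lemmas ip_simps = ip_add_left ip_add_right ip_diff_left ip_diff_right ip_csc_left ip_csc_right
  ip_minus_left ip_minus_right

lemma ip_self: "ip x x = of_real ((norm x)\<^sup>2)"
proof -
  have "Im (ip x x) = 0"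
    using cnj_ip[of x x] by (metis Reals_cnj_iff complex_is_Real_iff)
  then show ?thesis
    by (simp add: complex_eq_iff inner_eq_Re_ip[symmetric] power2_norm_eq_inner)
qed

lemma norm_sq_ell2: "(norm x)\<^sup>2 = (\<Sum>n. (cmod (coord x n))\<^sup>2)"
proof -
  have "ip x x = (\<Sum>n. of_real ((cmod (coord x n))\<^sup>2))"
    unfolding ip_def by (simp add: complex_mult_cnj cmod_power2)
  then show ?thesis
    by (metis ip_self of_real_eq_iff suminf_of_real summable_coord)
qed

lemma norm_csc [simp]: "norm (csc c x) = cmod c * norm x"
proof -
  have "complex_of_real ((norm (csc c x))\<^sup>2) = (c * cnj c) * ip x x"
    unfolding ip_self[symmetric] by (simp add: ip_simps mult_ac)
  then have "complex_of_real ((norm (csc c x))\<^sup>2) = of_real ((cmod c * norm x)\<^sup>2)"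
    by (simp add: ip_self complex_norm_square[symmetric] power_mult_distrib)
  then show ?thesis
    by (metis norm_ge_zero of_real_eq_iff power2_eq_iff_nonneg zero_le_mult_iff)
qed

lemma ip_Cauchy_Schwarz: "cmod (ip x y) \<le> norm x * norm y"
proof (cases "ip x y = 0")
  case False
  define u where "u = cnj (ip x y) / of_real (cmod (ip x y))"
  have u: "cmod u = 1" using False by (simp add: u_def norm_divide)
  have "ip (csc u x) y = of_real (cmod (ip x y))"
    using False by (simp add: ip_simps u_def complex_norm_square[symmetric] power2_eq_square mult.commute)
  then have "cmod (ip x y) = inner (csc u x) y" by (simp add: inner_eq_Re_ip)
  also have "\<dots> \<le> norm (csc u x) * norm y" by (rule norm_cauchy_schwarz)
  finally show ?thesis by (simp add: u)
qed simp

lemma ip_ext: "(\<And>x. ip x y = ip x z) \<Longrightarrow> y = z"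
  using ip_diff_right[of "y - z" y z] by (simp add: ip_self)

lemma sum_coord_le_norm: "(\<Sum>n<N. (cmod (coord x n))\<^sup>2) \<le> (norm x)\<^sup>2"
  unfolding norm_sq_ell2 by (intro sum_le_suminf summable_coord) auto

lemma norm_coord_le: "cmod (coord x n) \<le> norm x"
proof -
  have "(cmod (coord x n))\<^sup>2 \<le> (\<Sum>k<Suc n. (cmod (coord x k))\<^sup>2)"
    by (simp add: sum_nonneg)
  also have "\<dots> \<le> (norm x)\<^sup>2" by (rule sum_coord_le_norm)
  finally show ?thesis by (rule power2_le_imp_le) simp
qed

lemma norm_ell2_le:
  assumes "\<And>N. (\<Sum>n<N. (cmod (coord x n))\<^sup>2) \<le> B\<^sup>2" "B \<ge> 0"
  shows "norm x \<le> B"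
proof (rule power2_le_imp_le)
  show "(norm x)\<^sup>2 \<le> B\<^sup>2"
    unfolding norm_sq_ell2 by (intro suminf_le_const summable_coord assms)
qed (fact assms)

instance ell2 :: banach
proof
  fix X :: "nat \<Rightarrow> ell2"
  assume X: "Cauchy X"
  have "Cauchy (\<lambda>k. coord (X k) n)" for n
  proof (rule metric_CauchyI)
    fix e :: real assume "e > 0"
    then obtain M where "\<forall>m\<ge>M. \<forall>n\<ge>M. dist (X m) (X n) < e"
      using X by (meson metric_CauchyD)
    moreover have "dist (coord (X i) n) (coord (X j) n) \<le> dist (X i) (X j)" for i j
      using norm_coord_le[of "X i - X j" n] by (simp add: dist_norm)
    ultimately have "\<forall>i\<ge>M. \<forall>j\<ge>M. dist (coord (X i) n) (coord (X j) n) < e"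
      by (meson le_less_trans)
    then show "\<exists>M. \<forall>i\<ge>M. \<forall>j\<ge>M. dist (coord (X i) n) (coord (X j) n) < e" by blast
  qed
  then obtain l where l: "\<And>n. (\<lambda>k. coord (X k) n) \<longlonglongrightarrow> l n"
    unfolding Cauchy_convergent_iff convergent_def by metis
  \<comment> \<open>The bound is kept on finite partial sums because the limit sequence is not yet
    known to be square-summable.\<close>
  have tail: "\<exists>M. \<forall>k\<ge>M. \<forall>N. (\<Sum>n<N. (cmod (coord (X k) n - l n))\<^sup>2) \<le> e\<^sup>2" if "e > 0" for e
  proof -
    obtain M where M: "\<And>m k. m \<ge> M \<Longrightarrow> k \<ge> M \<Longrightarrow> dist (X m) (X k) < e"
      using X \<open>e > 0\<close> by (meson metric_CauchyD)
    have "(\<Sum>n<N. (cmod (coord (X k) n - l n))\<^sup>2) \<le> e\<^sup>2" if "k \<ge> M" for k N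
    proof (rule LIMSEQ_le_const2)
      show "(\<lambda>m. \<Sum>n<N. (cmod (coord (X k) n - coord (X m) n))\<^sup>2)
              \<longlonglongrightarrow> (\<Sum>n<N. (cmod (coord (X k) n - l n))\<^sup>2)"
        by (intro tendsto_intros l)
      have "(\<Sum>n<N. (cmod (coord (X k) n - coord (X m) n))\<^sup>2) \<le> e\<^sup>2" if "m \<ge> M" for m
      proof -
        have "(\<Sum>n<N. (cmod (coord (X k - X m) n))\<^sup>2) \<le> (norm (X k - X m))\<^sup>2"
          by (rule sum_coord_le_norm)
        also have "\<dots> \<le> e\<^sup>2"
          using M[of k m] that \<open>k \<ge> M\<close> by (intro power_mono) (auto simp: dist_norm)
        finally show ?thesis by simp
      qed
      then show "\<exists>M. \<forall>m\<ge>M. (\<Sum>n<N. (cmod (coord (X k) n - coord (X m) n))\<^sup>2) \<le> e\<^sup>2" by blast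
    qed
    then show ?thesis by blast
  qed
  obtain M where M: "\<And>N. (\<Sum>n<N. (cmod (coord (X M) n - l n))\<^sup>2) \<le> 1"
    using tail[of 1] by auto
  have "summable (\<lambda>n. (cmod (coord (X M) n - l n))\<^sup>2)"
    by (rule bounded_imp_summable[of _ 1])
      (use M in \<open>auto simp: lessThan_Suc_atMost[symmetric] simp del: sum.lessThan_Suc\<close>)
  \<comment> \<open>The limit is \<open>X M\<close> minus the square-summable difference
    \<open>X M - l\<close>.\<close>
  then have "summable (\<lambda>n. (cmod (coord (X M) n + - 1 * (coord (X M) n - l n)))\<^sup>2)"
    by (intro summable_sq_add summable_coord summable_sq_mult)
  then have sl: "summable (\<lambda>n. (cmod (l n))\<^sup>2)" by simp
  have "X \<longlonglongrightarrow> Ell2 l"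
  proof (rule metric_LIMSEQ_I)
    fix e :: real assume "e > 0"
    then obtain M where M: "\<And>k N. k \<ge> M \<Longrightarrow> (\<Sum>n<N. (cmod (coord (X k) n - l n))\<^sup>2) \<le> (e/2)\<^sup>2"
      using tail[of "e/2"] by auto
    have "dist (X k) (Ell2 l) < e" if "k \<ge> M" for k
    proof -
      have "norm (X k - Ell2 l) \<le> e/2"
        using M[OF that] \<open>e > 0\<close> by (intro norm_ell2_le) (auto simp: coord_Ell2[OF sl])
      then show ?thesis using \<open>e > 0\<close> by (simp add: dist_norm)
    qed
    then show "\<exists>M. \<forall>k\<ge>M. dist (X k) (Ell2 l) < e" by blast
  qed
  then show "convergent X" by (auto simp: convergent_def)
qed

section \<open>Identification of the Hardy space with square-summable sequences\<close>

lemma has_integral_cis: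
  "((\<lambda>t. cis (of_int k * t)) has_integral (if k = 0 then 2 * of_real pi else 0)) {0..2 * pi}"
proof (cases "k = 0")
  case True
  then show ?thesis
    using has_integral_const_real[of "1::complex" 0 "2 * pi"] by (simp add: scaleR_conv_of_real)
next
  case False
  define F where "F t = cis (of_int k * t) / (\<i> * of_int k)" for t :: real
  have "((\<lambda>t. cis (of_int k * t)) has_integral F (2 * pi) - F 0) {0..2 * pi}"
  proof (rule fundamental_theorem_of_calculus)
    fix t :: real
    have "((\<lambda>t. exp (\<i> * of_int k * t) / (\<i> * of_int k)) has_field_derivative
             exp (\<i> * of_int k * of_real t)) (at (of_real t))"
      using False by (auto intro!: derivative_eq_intros)
    then have "((\<lambda>t. exp (\<i> * of_int k * of_real t) / (\<i> * of_int k)) has_vector_derivative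
             exp (\<i> * of_int k * of_real t)) (at t within {0..2 * pi})"
      by (intro has_vector_derivative_real_field)
    then show "(F has_vector_derivative cis (of_int k * t)) (at t within {0..2 * pi})"
      by (simp add: F_def[abs_def] cis_conv_exp mult.assoc)
  qed simp
  moreover have "cis (of_int k * (2 * pi)) = 1"
    using cis_multiple_2pi[of "of_int k"] by (simp add: mult_ac)
  ultimately show ?thesis using False by (simp add: F_def)
qed

lemma has_integral_trig_poly:
  "((\<lambda>t. (\<Sum>i<N. c i * cis t ^ i) * cnj (\<Sum>i<N. c i * cis t ^ i)) has_integral
     2 * of_real pi * (\<Sum>i<N. of_real ((cmod (c i))\<^sup>2))) {0..2 * pi}"
proof -
  have eq: "(\<Sum>i<N. c i * cis t ^ i) * cnj (\<Sum>i<N. c i * cis t ^ i)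
      = (\<Sum>i<N. \<Sum>j<N. (c i * cnj (c j)) * cis (of_int (int i - int j) * t))" for t
  proof -
    have "cis t ^ i * cnj (cis t ^ j) = cis (of_int (int i - int j) * t)" for i j
    proof -
      have "cnj (cis t ^ j) = cis (- (real j * t))"
        unfolding Complex.DeMoivre by (simp add: cis_cnj)
      then show ?thesis by (simp only: Complex.DeMoivre cis_mult) (simp add: algebra_simps)
    qed
    then have "c i * cis t ^ i * (cnj (c j) * cnj (cis t ^ j))
        = (c i * cnj (c j)) * cis (of_int (int i - int j) * t)" for i j
      by (metis (no_types, opaque_lifting) mult.assoc mult.left_commute)
    then show ?thesis by (simp only: sum_product cnj_sum complex_cnj_mult)
  qed
  have "((\<lambda>t. \<Sum>i<N. \<Sum>j<N. (c i * cnj (c j)) * cis (of_int (int i - int j) * t)) has_integral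
     (\<Sum>i<N. \<Sum>j<N. (c i * cnj (c j)) * (if int i - int j = 0 then 2 * of_real pi else 0))) {0..2 * pi}"
    by (intro has_integral_sum has_integral_mult_right has_integral_cis) auto
  moreover have "(\<Sum>i<N. \<Sum>j<N. (c i * cnj (c j)) * (if int i - int j = 0 then 2 * of_real pi else 0))
      = (\<Sum>i<N. (c i * cnj (c i)) * (2 * of_real pi))"
    by (intro sum.cong refl) (simp add: if_distrib[of "\<lambda>x. _ * x"] sum.delta cong: if_cong)
  ultimately show ?thesis
    unfolding eq complex_norm_square by (simp only: sum_distrib_left mult.commute)
qed

text \<open>The radius of convergence exceeds \<open>r\<close>, so the partial sums converge
  uniformly on the circle of radius \<open>r\<close> and Parseval's formula for trigonometric
  polynomials passes to the limit.\<close>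

lemma hardy_mean_sums:
  assumes f: "\<And>z. cmod z < 1 \<Longrightarrow> (\<lambda>n. a n * z ^ n) sums f z" and r: "0 < r" "r < 1"
  shows "(\<lambda>n. (cmod (a n))\<^sup>2 * (r\<^sup>2) ^ n) sums hardy_mean f r"
proof -
  define P where "P N t = (\<Sum>n<N. (a n * of_real r ^ n) * cis t ^ n)" for N t
  define g where "g t = f (of_real r * cis t)" for t
  have "ereal r < conv_radius a"
  proof -
    have "summable (\<lambda>n. a n * of_real ((r + 1) / 2) ^ n)"
      using f[of "of_real ((r + 1) / 2)"] r by (simp add: sums_iff norm_divide flip: of_real_add)
    then have "conv_radius a \<ge> norm (of_real ((r + 1) / 2) :: complex)"
      by (rule conv_radius_geI)
    moreover have "norm (of_real ((r + 1) / 2) :: complex) > r"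
      using r unfolding norm_of_real by (simp add: abs_if)
    ultimately show ?thesis by (meson ereal_less_le less_ereal.simps(1) less_le_trans)
  qed
  then have "uniform_limit (cball 0 r) (\<lambda>n x. \<Sum>i<n. a i * (x - 0) ^ i)
      (\<lambda>x. suminf (\<lambda>i. a i * (x - 0) ^ i)) sequentially"
    by (rule powser_uniform_limit)
  then have "uniform_limit {0..2*pi} (\<lambda>n t. \<Sum>i<n. a i * (of_real r * cis t - 0) ^ i)
      (\<lambda>t. suminf (\<lambda>i. a i * (of_real r * cis t - 0) ^ i)) sequentially"
    by (rule uniform_limit_compose') (use r in \<open>auto simp: norm_mult\<close>)
  moreover have "suminf (\<lambda>i. a i * (of_real r * cis t - 0) ^ i) = g t" for t
    using f[of "of_real r * cis t"] r by (simp add: g_def norm_mult sums_iff)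
  ultimately have ul: "uniform_limit {0..2*pi} P g sequentially"
    by (simp add: P_def[abs_def] power_mult_distrib mult.assoc)
  have cP: "continuous_on {0..2*pi} (P N)" for N
    unfolding P_def by (intro continuous_intros)
  have cg: "continuous_on {0..2*pi} g"
    by (rule uniform_limit_theorem[OF _ ul]) (simp_all add: cP)
  have bg: "bounded (g ` {0..2*pi})"
    by (intro compact_imp_bounded compact_continuous_image cg) auto
  have "uniform_limit {0..2*pi} (\<lambda>N t. P N t * cnj (P N t)) (\<lambda>t. g t * cnj (g t)) sequentially"
  proof (intro uniform_lim_mult ul bg)
    show "uniform_limit {0..2*pi} (\<lambda>N t. cnj (P N t)) (\<lambda>t. cnj (g t)) sequentially"
      using bounded_linear.uniform_limit[OF bounded_linear_cnj ul] .
    show "bounded ((\<lambda>t. cnj (g t)) ` {0..2*pi})"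
      using bounded_linear_image[OF bg bounded_linear_cnj] by (simp add: image_image)
  qed
  then obtain I J where I: "\<And>n. ((\<lambda>t. P n t * cnj (P n t)) has_integral I n) {0..2*pi}"
    and J: "((\<lambda>t. g t * cnj (g t)) has_integral J) {0..2*pi}" and IJ: "I \<longlonglongrightarrow> J"
    by (rule uniform_limit_integral) (auto intro!: continuous_intros cP)
  have In: "I N = 2 * of_real pi * (\<Sum>i<N. of_real ((cmod (a i * of_real r ^ i))\<^sup>2))" for N
    using has_integral_unique[OF I[of N, unfolded P_def] has_integral_trig_poly] .
  have "((\<lambda>t. Re (g t * cnj (g t))) has_integral Re J) {0..2*pi}"
    using has_integral_linear[OF J bounded_linear_Re] by (simp add: o_def)
  then have "((\<lambda>t. (cmod (g t))\<^sup>2) has_integral Re J) {0..2*pi}"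
    by (simp add: complex_mult_cnj cmod_power2)
  then have "hardy_mean f r = Re J / (2 * pi)"
    unfolding hardy_mean_def g_def by (simp add: integral_unique)
  moreover have "(\<lambda>N. Re (I N) / (2 * pi)) \<longlonglongrightarrow> Re J / (2 * pi)"
    by (intro tendsto_intros IJ) auto
  moreover have "Re (I N) / (2 * pi) = (\<Sum>i<N. (cmod (a i))\<^sup>2 * (r\<^sup>2) ^ i)" for N
  proof -
    have "I N = of_real (2 * pi * (\<Sum>i<N. (cmod (a i * of_real r ^ i))\<^sup>2))"
      unfolding In by simp
    then have "Re (I N) = 2 * pi * (\<Sum>i<N. (cmod (a i * of_real r ^ i))\<^sup>2)" by simp
    then show ?thesis using r
      by (simp add: norm_mult norm_power power_mult_distrib power2_eq_square mult_ac)
  qed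
  ultimately show ?thesis unfolding sums_def by simp
qed

section \<open>The Szego kernel and point evaluation\<close>

definition ker :: "complex \<Rightarrow> ell2" where
  "ker w = Ell2 (\<lambda>n. cnj w ^ n)"

lemma coord_ker:
  assumes "cmod w < 1"
  shows "coord (ker w) n = cnj w ^ n"
proof -
  have "(cmod w)\<^sup>2 < 1" using assms by (simp add: abs_square_less_1)
  then have "summable (\<lambda>n. ((cmod w)\<^sup>2) ^ n)" by (intro summable_geometric) simp
  then have "summable (\<lambda>n. (cmod (cnj w ^ n))\<^sup>2)"
    by (simp add: norm_power power2_eq_square power_mult_distrib)
  then show ?thesis unfolding ker_def by (subst coord_Ell2) auto
qed

text \<open>Evaluation is encoded as a pairing with the kernel, which makes it linear and continuous
  at once; the value 0 off the disk matches the convention of \<open>hardy_space\<close>.\<close>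

definition ev :: "ell2 \<Rightarrow> complex \<Rightarrow> complex" where
  "ev x z = (if z \<in> unit_disk then ip x (ker z) else 0)"

lemma ev_eq_ip: "cmod z < 1 \<Longrightarrow> ev x z = ip x (ker z)"
  by (simp add: ev_def)

lemma ev_outside: "z \<notin> unit_disk \<Longrightarrow> ev x z = 0"
  by (simp add: ev_def)

lemma ev_sums:
  assumes "cmod z < 1"
  shows "(\<lambda>n. coord x n * z ^ n) sums ev x z"
  using summable_ip[of x "ker z"] assms
  by (simp add: ev_eq_ip ip_def coord_ker sums_iff)

lemma ev_add: "ev (x + y) z = ev x z + ev y z"
  by (simp add: ev_def ip_simps)

lemma ev_diff: "ev (x - y) z = ev x z - ev y z"
  by (simp add: ev_def ip_simps)

lemma ev_csc: "ev (csc c x) z = c * ev x z"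
  by (simp add: ev_def ip_simps)

lemmas ev_simps = ev_add ev_diff ev_csc

lemma ev_0: "ev x 0 = coord x 0"
  using sums_unique2[OF ev_sums[of 0 x] powser_sums_zero[of "coord x"]] by simp

lemma ev_holomorphic: "ev x holomorphic_on unit_disk"
  by (rule power_series_holomorphic[where a = "coord x" and z = 0]) (use ev_sums in auto)

section \<open>The isometry from sequences onto the Hardy space\<close>

lemma hardy_mean_ev:
  assumes "0 < r" "r < 1"
  shows "(\<lambda>n. (cmod (coord x n))\<^sup>2 * (r\<^sup>2) ^ n) sums hardy_mean (ev x) r"
  by (rule hardy_mean_sums) (use assms in \<open>auto intro: ev_sums\<close>)

lemma hardy_mean_ev_le:
  assumes "0 < r" "r < 1"
  shows "hardy_mean (ev x) r \<le> (norm x)\<^sup>2"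
  unfolding norm_sq_ell2
proof (rule sums_le[OF _ hardy_mean_ev[OF assms]])
  show "(\<lambda>n. (cmod (coord x n))\<^sup>2) sums (\<Sum>n. (cmod (coord x n))\<^sup>2)"
    using summable_coord summable_sums by blast
  show "(cmod (coord x n))\<^sup>2 * (r\<^sup>2) ^ n \<le> (cmod (coord x n))\<^sup>2" for n
    using assms by (intro mult_left_le) (auto intro!: power_le_one simp: abs_square_le_1)
qed

text \<open>Letting \<open>r\<close> tend to 1 in the partial sums of Parseval's formula.\<close>

lemma sum_sq_le_of_hardy_mean_le:
  assumes f: "\<And>z. cmod z < 1 \<Longrightarrow> (\<lambda>n. a n * z ^ n) sums f z"
    and B: "\<And>r. 0 < r \<Longrightarrow> r < 1 \<Longrightarrow> hardy_mean f r \<le> B"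
  shows "(\<Sum>n<N. (cmod (a n))\<^sup>2) \<le> B"
proof (rule tendsto_upperbound)
  have "((\<lambda>r::real. \<Sum>n<N. (cmod (a n))\<^sup>2 * (r\<^sup>2) ^ n) \<longlongrightarrow> (\<Sum>n<N. (cmod (a n))\<^sup>2 * (1\<^sup>2) ^ n)) (at_left 1)"
    by (intro tendsto_intros)
  then show "((\<lambda>r::real. \<Sum>n<N. (cmod (a n))\<^sup>2 * (r\<^sup>2) ^ n) \<longlongrightarrow> (\<Sum>n<N. (cmod (a n))\<^sup>2)) (at_left 1)"
    by simp
  have "(\<Sum>n<N. (cmod (a n))\<^sup>2 * (r\<^sup>2) ^ n) \<le> B" if r: "r \<in> {0<..<1}" for r :: real
  proof -
    have "(\<lambda>n. (cmod (a n))\<^sup>2 * (r\<^sup>2) ^ n) sums hardy_mean f r"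
      using f r by (intro hardy_mean_sums) auto
    then have "(\<Sum>n<N. (cmod (a n))\<^sup>2 * (r\<^sup>2) ^ n) \<le> hardy_mean f r"
      using sum_le_suminf[of "\<lambda>n. (cmod (a n))\<^sup>2 * (r\<^sup>2) ^ n" "{..<N}"] by (auto simp: sums_iff)
    also have "\<dots> \<le> B" using B r by auto
    finally show ?thesis .
  qed
  moreover have "eventually (\<lambda>r. r \<in> {0<..<1::real}) (at_left 1)"
    by (rule eventually_at_left_real) simp
  ultimately show "eventually (\<lambda>r::real. (\<Sum>n<N. (cmod (a n))\<^sup>2 * (r\<^sup>2) ^ n) \<le> B) (at_left 1)"
    by (rule eventually_mono[rotated])
qed simp

lemma norm_le_of_hardy_mean_le:
  assumes "\<And>r. 0 < r \<Longrightarrow> r < 1 \<Longrightarrow> hardy_mean (ev x) r \<le> B\<^sup>2" "B \<ge> 0"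
  shows "norm x \<le> B"
  using assms by (intro norm_ell2_le sum_sq_le_of_hardy_mean_le[where f = "ev x"] ev_sums) auto

lemma ev_in_hardy: "ev x \<in> hardy_space"
proof -
  have "bdd_above (hardy_mean (ev x) ` {0<..<1})"
    by (rule bdd_aboveI[of _ "(norm x)\<^sup>2"]) (auto intro: hardy_mean_ev_le)
  then show ?thesis by (simp add: hardy_space_def ev_holomorphic ev_outside)
qed

lemma hardy_norm_ev: "hardy_norm (ev x) = norm x"
proof -
  define M where "M = (SUP r\<in>{0<..<1}. hardy_mean (ev x) r)"
  have bdd: "bdd_above (hardy_mean (ev x) ` {0<..<1})"
    using ev_in_hardy[of x] by (simp add: hardy_space_def)
  have ne: "{0<..<1::real} \<noteq> {}" by simp
  have "M \<le> (norm x)\<^sup>2"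
    unfolding M_def by (rule cSUP_least[OF ne]) (auto intro: hardy_mean_ev_le)
  moreover have "M \<ge> 0"
    using hardy_norm_nonneg[OF ev_in_hardy] by (simp add: hardy_norm_def M_def)
  moreover have "norm x \<le> sqrt M"
  proof (rule norm_le_of_hardy_mean_le)
    show "hardy_mean (ev x) r \<le> (sqrt M)\<^sup>2" if "0 < r" "r < 1" for r
      using cSUP_upper[OF _ bdd, of r] that \<open>M \<ge> 0\<close> by (auto simp: M_def)
  qed (use \<open>M \<ge> 0\<close> in auto)
  ultimately show ?thesis
    unfolding hardy_norm_def M_def[symmetric] by (simp add: real_le_lsqrt order_antisym)
qed

lemma hardy_ev_surj:
  assumes f: "f \<in> hardy_space"
  obtains x where "ev x = f"
proof -
  define a where "a n = (deriv ^^ n) f 0 / fact n" for n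
  have a: "(\<lambda>n. a n * z ^ n) sums f z" if "cmod z < 1" for z
    using holomorphic_power_series[of f 0 1 z] f that by (simp add: hardy_space_def a_def)
  obtain B where B: "\<And>r. 0 < r \<Longrightarrow> r < 1 \<Longrightarrow> hardy_mean f r \<le> B"
    using f by (force simp: hardy_space_def bdd_above_def)
  have sa: "summable (\<lambda>n. (cmod (a n))\<^sup>2)"
  proof (rule bounded_imp_summable)
    show "(\<Sum>k\<le>n. (cmod (a k))\<^sup>2) \<le> B" for n
      using sum_sq_le_of_hardy_mean_le[of a f B "Suc n", OF a B] by (simp only: lessThan_Suc_atMost)
  qed simp
  have "ev (Ell2 a) z = f z" for z
  proof (cases "cmod z < 1")
    case True
    then show ?thesis
      using ev_sums[OF True, of "Ell2 a"] a[OF True] by (simp add: coord_Ell2[OF sa] sums_iff)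
  next
    case False
    then show ?thesis using f by (simp add: ev_def hardy_space_def)
  qed
  then show ?thesis using that by blast
qed

lemma ev_inject:
  assumes "\<And>z. cmod z < 1 \<Longrightarrow> ev x z = ev y z"
  shows "x = y"
proof -
  have "ev (x - y) z = ev 0 z" for z
    using assms[of z] by (cases "cmod z < 1") (simp_all add: ev_diff ev_outside, simp add: ev_def)
  then have "norm (x - y) = norm (0 :: ell2)"
    by (metis ext hardy_norm_ev)
  then show ?thesis by simp
qed

lemma hardy_inner_ev: "hardy_inner (ev x) (ev y) = ip x y"
proof -
  have "of_real ((hardy_norm (ev x + fun_scale c (ev y)))\<^sup>2) = ip (x + csc c y) (x + csc c y)" for c
  proof -
    have "ev x + fun_scale c (ev y) = ev (x + csc c y)"
      by (auto simp: fun_scale_def ev_simps)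
    then show ?thesis by (simp add: hardy_norm_ev ip_self)
  qed
  then show ?thesis
    unfolding hardy_inner_def by (simp add: ip_simps numeral_eq_Suc algebra_simps)
qed

definition coeffs :: "(complex \<Rightarrow> complex) \<Rightarrow> ell2" where
  "coeffs f = (SOME x. ev x = f)"

lemma ev_coeffs: "f \<in> hardy_space \<Longrightarrow> ev (coeffs f) = f"
  unfolding coeffs_def by (metis (mono_tags) hardy_ev_surj someI)

lemma coeffs_ev: "coeffs (ev x) = x"
  by (metis ev_coeffs ev_in_hardy ev_inject)

section \<open>Operators on the Hardy space\<close>

lemma bounded_linear_ip_left: "bounded_linear (\<lambda>x. ip x y)"
proof (rule bounded_linear_intro[where K = "norm y"])
  show "ip (r *\<^sub>R x) y = r *\<^sub>R ip x y" for r x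
    unfolding csc_of_real[symmetric] ip_csc_left scaleR_conv_of_real ..
qed (simp_all add: ip_add_left ip_Cauchy_Schwarz)

lemma csc_add: "csc c (x + y) = csc c x + csc c y"
  by (rule ell2_eqI) (simp add: algebra_simps)

lemma csc_scaleR: "csc c (r *\<^sub>R x) = r *\<^sub>R csc c x"
  by (rule ell2_eqI) simp

lemma bounded_linear_csc: "bounded_linear (csc c)"
  by (rule bounded_linear_intro[where K = "cmod c"]) (simp_all add: csc_add csc_scaleR mult.commute)





text \<open>Polarization: norms determine the real part of \<open>ip\<close>, and the imaginary part
  is the real part after multiplying the second argument by \<open>\<i>\<close>.\<close>

lemma isometry_imp_ip:
  assumes add: "\<And>x y. f (x + y) = f x + f y" and sc: "\<And>c x. f (csc c x) = csc c (f x)"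
    and norm: "\<And>x. norm (f x) = norm x"
  shows "ip (f x) (f y) = ip x y"
proof -
  have re: "Re (ip (f x) (f y)) = Re (ip x y)" for x y
    using norm[of "x + y"] norm[of x] norm[of y]
    by (simp add: inner_eq_Re_ip[symmetric] add dot_norm)
  have "Re (ip x (csc \<i> y)) = Im (ip x y)" for x y
    by (simp add: ip_simps)
  then have "Im (ip (f x) (f y)) = Im (ip x y)"
    using re[of x "csc \<i> y"] by (metis sc)
  with re show ?thesis by (simp add: complex_eq_iff)
qed

subsection \<open>Shift, dilation and conjugation of coefficients\<close>

lemma summable_case_nat:
  "summable (\<lambda>n. (cmod (case n of 0 \<Rightarrow> 0 | Suc m \<Rightarrow> a m))\<^sup>2) \<longleftrightarrow> summable (\<lambda>n. (cmod (a n))\<^sup>2)"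
  by (subst summable_Suc_iff[symmetric]) simp

lift_definition shift :: "ell2 \<Rightarrow> ell2" is "\<lambda>a n. case n of 0 \<Rightarrow> 0 | Suc m \<Rightarrow> a m"
  by (simp add: summable_case_nat)

lift_definition bshift :: "ell2 \<Rightarrow> ell2" is "\<lambda>a n. a (Suc n)"
  subgoal for a using summable_Suc_iff[of "\<lambda>n. (cmod (a n))\<^sup>2"] by simp
  done

lift_definition conj_coeffs :: "ell2 \<Rightarrow> ell2" is "\<lambda>a n. cnj (a n)" by simp

lemmas [simp] = bshift.rep_eq conj_coeffs.rep_eq

lemma coord_shift_0 [simp]: "coord (shift x) 0 = 0"
  and coord_shift_Suc [simp]: "coord (shift x) (Suc n) = coord x n"
  by (simp_all add: shift.rep_eq)

text \<open>Composition with \<open>z \<mapsto> l * z\<close>. It is not lifted because the new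
  sequence can fail to be square-summable when \<open>cmod l > 1\<close>.\<close>

definition dil :: "complex \<Rightarrow> ell2 \<Rightarrow> ell2" where
  "dil l x = Ell2 (\<lambda>n. l ^ n * coord x n)"

lemma coord_dil:
  assumes "cmod l = 1"
  shows "coord (dil l x) n = l ^ n * coord x n"
proof -
  have "summable (\<lambda>n. (cmod (l ^ n * coord x n))\<^sup>2)"
    using summable_coord[of x] assms by (simp add: norm_mult norm_power)
  then show ?thesis unfolding dil_def by (simp add: coord_Ell2)
qed

lemma bshift_shift [simp]: "bshift (shift x) = x"
  by (rule ell2_eqI) simp

lemma ip_shift_left: "ip (shift x) y = ip x (bshift y)"
proof -
  have "ip (shift x) y = (\<Sum>n. coord (shift x) (Suc n) * cnj (coord y (Suc n)))"
    using suminf_split_head[OF summable_ip[of "shift x" y]] by (simp add: ip_def)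
  then show ?thesis by (simp add: ip_def)
qed

lemma ip_shift_shift [simp]: "ip (shift x) (shift y) = ip x y"
  by (simp add: ip_shift_left)

lemma norm_shift [simp]: "norm (shift x) = norm x"
  using ip_shift_shift[of x x] by (simp add: ip_self flip: of_real_power)

lemma ev_shift: "ev (shift x) z = z * ev x z"
proof (cases "cmod z < 1")
  case True
  have "bshift (ker z) = csc (cnj z) (ker z)"
    using True by (intro ell2_eqI) (simp add: coord_ker)
  then show ?thesis using True by (simp add: ev_eq_ip ip_shift_left ip_simps)
qed (simp add: ev_def)

lemma ip_dil_left:
  assumes "cmod l = 1"
  shows "ip (dil l x) y = ip x (dil (cnj l) y)"
  using assms by (simp add: ip_def coord_dil mult_ac)

lemma ip_dil_dil:
  assumes "cmod l = 1"
  shows "ip (dil l x) (dil l y) = ip x y"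
proof -
  have "l ^ n * cnj l ^ n = 1" for n
    using assms by (simp add: complex_norm_square[symmetric] flip: power_mult_distrib)
  then have "l ^ n * u * cnj (l ^ n * v) = u * cnj v" for n u v
    by (metis (no_types, lifting) complex_cnj_mult complex_cnj_power mult.assoc mult.commute mult_1)
  then show ?thesis
    using assms by (simp only: ip_def coord_dil)
qed

lemma ev_dil:
  assumes "cmod l = 1"
  shows "ev (dil l x) z = ev x (l * z)"
proof (cases "cmod z < 1")
  case True
  then have "(\<lambda>n. coord x n * (l * z) ^ n) sums ev (dil l x) z"
    using ev_sums[OF True, of "dil l x"] assms by (simp add: coord_dil power_mult_distrib mult_ac)
  moreover have "(\<lambda>n. coord x n * (l * z) ^ n) sums ev x (l * z)"
    using True assms by (intro ev_sums) (simp add: norm_mult)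
  ultimately show ?thesis by (rule sums_unique2)
qed (use assms in \<open>simp add: ev_def norm_mult\<close>)

lemma ip_conj_coeffs: "ip (conj_coeffs x) (conj_coeffs y) = ip y x"
  by (simp add: ip_def mult.commute)

lemma conj_coeffs_conj_coeffs [simp]: "conj_coeffs (conj_coeffs x) = x"
  by (rule ell2_eqI) simp

lemma ev_conj_coeffs: "ev (conj_coeffs x) z = cnj (ev x (cnj z))"
proof (cases "cmod z < 1")
  case True
  have "(\<lambda>n. cnj (coord x n * cnj z ^ n)) sums cnj (ev x (cnj z))"
    unfolding sums_cnj using True by (intro ev_sums) simp
  then show ?thesis
    using ev_sums[OF True, of "conj_coeffs x"] by (simp add: sums_iff)
qed (simp add: ev_def)

subsection \<open>Multiplication operators\<close>

text \<open>The pointwise bound on the multiplier is integrated over each circle, so the means grow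
  by at most the factor \<open>B\<^sup>2\<close>.\<close>

lemma mult_in_hardy:
  assumes hol: "m holomorphic_on unit_disk" and B: "\<And>z. cmod z < 1 \<Longrightarrow> cmod (m z) \<le> B"
  shows "ev (coeffs (\<lambda>z. m z * ev x z)) z = m z * ev x z"
    and "norm (coeffs (\<lambda>z. m z * ev x z)) \<le> B * norm x"
proof -
  define f where "f z = m z * ev x z" for z
  have B0: "B \<ge> 0" using B[of 0] by (metis norm_ge_zero norm_zero order_trans zero_less_one)
  have mean: "hardy_mean f r \<le> (B * norm x)\<^sup>2" if r: "0 < r" "r < 1" for r
  proof -
    have c: "continuous_on {0..2*pi} (\<lambda>t. g (of_real r * cis t))"
      if "g holomorphic_on unit_disk" for g
      by (rule continuous_on_compose2[OF holomorphic_on_imp_continuous_on[OF that]])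
        (use r in \<open>auto intro!: continuous_intros simp: norm_mult\<close>)
    have "integral {0..2*pi} (\<lambda>t. (cmod (f (of_real r * cis t)))\<^sup>2)
        \<le> integral {0..2*pi} (\<lambda>t. B\<^sup>2 * (cmod (ev x (of_real r * cis t)))\<^sup>2)"
    proof (rule integral_le)
      show "(\<lambda>t. (cmod (f (of_real r * cis t)))\<^sup>2) integrable_on {0..2*pi}"
        unfolding f_def
        by (intro integrable_continuous_real continuous_intros c hol ev_holomorphic)
      show "(\<lambda>t. B\<^sup>2 * (cmod (ev x (of_real r * cis t)))\<^sup>2) integrable_on {0..2*pi}"
        by (intro integrable_continuous_real continuous_intros c ev_holomorphic)
      show "(cmod (f (of_real r * cis t)))\<^sup>2 \<le> B\<^sup>2 * (cmod (ev x (of_real r * cis t)))\<^sup>2" for t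
        unfolding f_def norm_mult power_mult_distrib
        using B[of "of_real r * cis t"] r by (intro mult_right_mono power_mono) (auto simp: norm_mult)
    qed
    also have "\<dots> = B\<^sup>2 * integral {0..2*pi} (\<lambda>t. (cmod (ev x (of_real r * cis t)))\<^sup>2)"
      by (rule integral_mult_right)
    finally have "hardy_mean f r \<le> B\<^sup>2 * hardy_mean (ev x) r"
      unfolding hardy_mean_def by (simp add: divide_right_mono)
    also have "\<dots> \<le> B\<^sup>2 * (norm x)\<^sup>2"
      by (intro mult_left_mono hardy_mean_ev_le r) auto
    finally show ?thesis by (simp add: power_mult_distrib)
  qed
  have "f \<in> hardy_space"
  proof -
    have "bdd_above (hardy_mean f ` {0<..<1})"
      by (rule bdd_aboveI[of _ "(B * norm x)\<^sup>2"]) (auto intro: mean)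
    moreover have "f holomorphic_on unit_disk"
      unfolding f_def by (intro holomorphic_intros hol ev_holomorphic)
    ultimately show ?thesis
      by (simp add: hardy_space_def) (simp add: f_def ev_outside)
  qed
  then have ev: "ev (coeffs f) = f" by (rule ev_coeffs)
  then show "ev (coeffs (\<lambda>z. m z * ev x z)) z = m z * ev x z"
    by (simp add: f_def[abs_def])
  have "norm (coeffs f) \<le> B * norm x"
    by (rule norm_le_of_hardy_mean_le) (use mean B0 in \<open>simp_all add: ev\<close>)
  then show "norm (coeffs (\<lambda>z. m z * ev x z)) \<le> B * norm x"
    by (simp add: f_def[abs_def])
qed

subsection \<open>Involutive disk automorphisms\<close>

definition mob :: "complex \<Rightarrow> complex \<Rightarrow> complex" where
  "mob a z = (a - z) / (1 - cnj a * z)"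

lemma one_minus_cnj_mult_ge:
  assumes "cmod a < 1" "cmod z < 1"
  shows "cmod (1 - cnj a * z) \<ge> 1 - cmod a"
proof -
  have "cmod (cnj a * z) \<le> cmod a"
    using assms by (simp add: norm_mult mult_left_le)
  then show ?thesis
    using norm_triangle_ineq2[of 1 "cnj a * z"] by simp
qed

lemma one_minus_cnj_mult_neq_0:
  assumes "cmod a < 1" "cmod z < 1"
  shows "1 - cnj a * z \<noteq> 0"
  using one_minus_cnj_mult_ge[OF assms] assms by auto

lemma norm_mob_identity:
  "(cmod (1 - cnj a * z))\<^sup>2 - (cmod (a - z))\<^sup>2 = (1 - (cmod a)\<^sup>2) * (1 - (cmod z)\<^sup>2)"
  by (simp only: cmod_power2 minus_complex.sel one_complex.sel times_complex.sel cnj.sel) algebra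

lemma norm_mob:
  assumes "cmod a < 1" "cmod z < 1"
  shows "cmod (mob a z) < 1"
proof -
  have "(1 - (cmod a)\<^sup>2) * (1 - (cmod z)\<^sup>2) > 0"
    using assms by (intro mult_pos_pos) (auto simp: abs_square_less_1)
  then have "(cmod (a - z))\<^sup>2 < (cmod (1 - cnj a * z))\<^sup>2"
    using norm_mob_identity[of a z] by linarith
  then have "cmod (a - z) < cmod (1 - cnj a * z)"
    by (rule power2_less_imp_less) simp
  then show ?thesis
    using one_minus_cnj_mult_neq_0[OF assms] by (simp add: mob_def norm_divide)
qed

lemma one_minus_norm_sq_pos: "cmod a < 1 \<Longrightarrow> 1 - (cmod a)\<^sup>2 > 0"
  by (simp add: abs_square_less_1)

lemma one_minus_cnj_mult_mob:
  assumes "cmod a < 1" "cmod z < 1"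
  shows "1 - cnj a * mob a z = of_real (1 - (cmod a)\<^sup>2) / (1 - cnj a * z)"
  using one_minus_cnj_mult_neq_0[OF assms] complex_norm_square[of a]
  by (simp add: mob_def field_simps)

lemma mob_mob:
  assumes "cmod a < 1" "cmod z < 1"
  shows "mob a (mob a z) = z"
proof -
  have ne: "1 - cnj a * z \<noteq> 0" by (rule one_minus_cnj_mult_neq_0[OF assms])
  have ne2: "of_real (1 - (cmod a)\<^sup>2) \<noteq> (0 :: complex)"
    using one_minus_norm_sq_pos[OF assms(1)] by (metis less_irrefl of_real_eq_0_iff)
  have "a - mob a z = z * of_real (1 - (cmod a)\<^sup>2) / (1 - cnj a * z)"
    using ne complex_norm_square[of a] by (simp add: mob_def field_simps)
  then show ?thesis
    unfolding mob_def[of a "mob a z"] one_minus_cnj_mult_mob[OF assms] using ne ne2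
    by simp
qed

lemma mob_0 [simp]: "mob a 0 = a" and mob_self [simp]: "mob a a = 0"
  by (simp_all add: mob_def)

lemma mob_holomorphic:
  assumes "cmod a < 1"
  shows "mob a holomorphic_on unit_disk"
  unfolding mob_def using one_minus_cnj_mult_neq_0[OF assms]
  by (auto intro!: holomorphic_intros)

lemma ev_ker:
  assumes "cmod a < 1" "cmod z < 1"
  shows "ev (ker a) z = 1 / (1 - cnj a * z)"
proof -
  have "cmod (cnj a * z) < 1"
    using assms mult_left_le[of "cmod z" "cmod a"] by (simp add: norm_mult)
  then have "(\<lambda>n. (cnj a * z) ^ n) sums (1 / (1 - cnj a * z))"
    by (rule geometric_sums)
  then show ?thesis
    using ev_sums[OF assms(2), of "ker a"] assms
    by (simp add: coord_ker power_mult_distrib sums_iff)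
qed

definition mob_mult :: "complex \<Rightarrow> ell2 \<Rightarrow> ell2" where
  "mob_mult a x = coeffs (\<lambda>z. mob a z * ev x z)"

lemma ev_mob_mult:
  assumes "cmod a < 1"
  shows "ev (mob_mult a x) z = mob a z * ev x z"
  unfolding mob_mult_def
  by (rule mult_in_hardy(1)[OF mob_holomorphic[OF assms], of 1]) (use norm_mob[OF assms] in force)

text \<open>With \<open>y = x / (1 - cnj a z)\<close> both \<open>x\<close> and its multiple by \<open>mob a\<close> are linear
  combinations of \<open>y\<close> and its shift, so the claim reduces to the shift being isometric.\<close>

lemma ip_mob_mult:
  assumes a: "cmod a < 1"
  shows "ip (mob_mult a x) (mob_mult a y) = ip x y"
proof -
  define R where "R x = coeffs (\<lambda>z. 1 / (1 - cnj a * z) * ev x z)" for x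
  have R: "ev (R x) z = 1 / (1 - cnj a * z) * ev x z" for x z
    unfolding R_def
  proof (rule mult_in_hardy(1))
    show "(\<lambda>z. 1 / (1 - cnj a * z)) holomorphic_on unit_disk"
      using one_minus_cnj_mult_neq_0[OF a] by (auto intro!: holomorphic_intros)
    show "cmod (1 / (1 - cnj a * z)) \<le> 1 / (1 - cmod a)" if "cmod z < 1" for z
      using one_minus_cnj_mult_ge[OF a that] a by (simp add: norm_divide frac_le)
  qed
  have 1: "x = R x - csc (cnj a) (shift (R x))" for x
  proof (rule ev_inject)
    fix z :: complex assume "cmod z < 1"
    then have "ev x z = (1 - cnj a * z) / (1 - cnj a * z) * ev x z"
      using one_minus_cnj_mult_neq_0[OF a] by simp
    also have "\<dots> = ev (R x - csc (cnj a) (shift (R x))) z"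
      by (simp only: ev_simps ev_shift R diff_divide_distrib) (simp add: algebra_simps)
    finally show "ev x z = ev (R x - csc (cnj a) (shift (R x))) z" .
  qed
  have 2: "mob_mult a x = csc a (R x) - shift (R x)" for x
    by (rule ev_inject)
      (simp add: ev_simps ev_shift R ev_mob_mult[OF a] mob_def diff_divide_distrib algebra_simps)
  have "ip (R x - csc (cnj a) (shift (R x))) (R y - csc (cnj a) (shift (R y)))
      = ip (csc a (R x) - shift (R x)) (csc a (R y) - shift (R y))"
    by (simp add: ip_simps algebra_simps)
  then show ?thesis by (simp only: 1[symmetric] 2[symmetric])
qed

subsection \<open>Composition with an involutive disk automorphism\<close>

lemma ip_sum_left: "ip (sum f A) y = (\<Sum>i\<in>A. ip (f i) y)"
  using bounded_linear.linear[OF bounded_linear_ip_left] by (rule linear_sum)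

lemma ip_sum_right: "ip x (sum f A) = (\<Sum>i\<in>A. ip x (f i))"
proof -
  have "ip x (sum f A) = cnj (ip (sum f A) x)" by (simp add: cnj_ip)
  then show ?thesis unfolding ip_sum_left by (simp add: cnj_ip)
qed

section \<open>Orthonormal expansions and the weighted unitary involution\<close>

lemma orthonormal_series:
  assumes on: "\<And>n m. ip (e n) (e m) = (if n = m then 1 else 0)"
    and c: "summable (\<lambda>n. (cmod (c n))\<^sup>2)"
  shows "summable (\<lambda>n. csc (c n) (e n))"
    and "(norm (\<Sum>n. csc (c n) (e n)))\<^sup>2 = (\<Sum>n. (cmod (c n))\<^sup>2)"
proof -
  have norm_sum: "(norm (\<Sum>n\<in>A. csc (c n) (e n)))\<^sup>2 = (\<Sum>n\<in>A. (cmod (c n))\<^sup>2)" if "finite A" for A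
  proof -
    have "complex_of_real ((norm (\<Sum>n\<in>A. csc (c n) (e n)))\<^sup>2)
        = (\<Sum>n\<in>A. \<Sum>m\<in>A. if n = m then c n * cnj (c n) else 0)"
      unfolding ip_self[symmetric] ip_sum_left ip_sum_right
      by (intro sum.cong refl) (simp add: ip_simps on)
    also have "\<dots> = (\<Sum>n\<in>A. of_real ((cmod (c n))\<^sup>2))"
      using that by (simp only: sum.delta complex_norm_square) (auto intro!: sum.cong)
    finally show ?thesis by (metis of_real_eq_iff of_real_sum)
  qed
  show s: "summable (\<lambda>n. csc (c n) (e n))"
    unfolding summable_Cauchy
  proof (intro allI impI)
    fix r :: real assume "r > 0"
    then obtain N where N: "\<And>m n. m \<ge> N \<Longrightarrow> norm (\<Sum>k\<in>{m..<n}. (cmod (c k))\<^sup>2) < r\<^sup>2"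
      using c unfolding summable_Cauchy by (metis zero_less_power)
    have "norm (\<Sum>k\<in>{m..<n}. csc (c k) (e k)) < r" if "m \<ge> N" for m n
    proof -
      have "(norm (\<Sum>k\<in>{m..<n}. csc (c k) (e k)))\<^sup>2 < r\<^sup>2"
        using N[OF that, of n] by (simp add: norm_sum)
      then show ?thesis using \<open>r > 0\<close> by (intro power2_less_imp_less[of _ r]) auto
    qed
    then show "\<exists>N. \<forall>m\<ge>N. \<forall>n. norm (\<Sum>k\<in>{m..<n}. csc (c k) (e k)) < r" by blast
  qed
  have "(\<lambda>N. (norm (\<Sum>n<N. csc (c n) (e n)))\<^sup>2) \<longlonglongrightarrow> (norm (\<Sum>n. csc (c n) (e n)))\<^sup>2"
    by (intro tendsto_intros summable_LIMSEQ s)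
  moreover have "(\<lambda>N. \<Sum>n<N. (cmod (c n))\<^sup>2) \<longlonglongrightarrow> (\<Sum>n. (cmod (c n))\<^sup>2)"
    by (rule summable_LIMSEQ[OF c])
  ultimately show "(norm (\<Sum>n. csc (c n) (e n)))\<^sup>2 = (\<Sum>n. (cmod (c n))\<^sup>2)"
    by (simp add: norm_sum LIMSEQ_unique)
qed

text \<open>For \<open>a\<close> in the disk this is the reciprocal of the norm of
  \<open>ker a\<close>.\<close>

definition mob_scale :: "complex \<Rightarrow> complex" where
  "mob_scale a = of_real (sqrt (1 - (cmod a)\<^sup>2))"

lemma mob_scale_sq: "cmod a < 1 \<Longrightarrow> mob_scale a * mob_scale a = of_real (1 - (cmod a)\<^sup>2)"
  using one_minus_norm_sq_pos[of a] unfolding mob_scale_def of_real_mult[symmetric] by simp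

lemma mob_scale_neq_0: "cmod a < 1 \<Longrightarrow> mob_scale a \<noteq> 0"
  using one_minus_norm_sq_pos[of a] by (simp add: mob_scale_def)

lemma cnj_mob_scale [simp]: "cnj (mob_scale a) = mob_scale a"
  by (simp add: mob_scale_def)

lemma ev_mob_mult_pow:
  assumes "cmod a < 1"
  shows "ev ((mob_mult a ^^ n) x) z = mob a z ^ n * ev x z"
  by (induction n) (simp_all add: ev_mob_mult[OF assms])

lemma ip_mob_mult_pow:
  assumes "cmod a < 1"
  shows "ip ((mob_mult a ^^ n) x) ((mob_mult a ^^ n) y) = ip x y"
  by (induction n) (simp_all add: ip_mob_mult[OF assms])

text \<open>The Takenaka-Malmquist system with all its points equal to \<open>a\<close>; these are
  the images of the monomials under the weighted composition to be constructed.\<close>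

definition mob_basis :: "complex \<Rightarrow> nat \<Rightarrow> ell2" where
  "mob_basis a n = csc (mob_scale a) ((mob_mult a ^^ n) (ker a))"

lemma ev_mob_basis:
  assumes "cmod a < 1" "cmod z < 1"
  shows "ev (mob_basis a n) z = mob_scale a / (1 - cnj a * z) * mob a z ^ n"
  by (simp add: mob_basis_def ev_csc ev_mob_mult_pow ev_ker assms)

text \<open>The common powers of the isometry \<open>mob_mult a\<close> cancel. What remains is a
  pairing with \<open>ker a\<close>, that is, evaluation at \<open>a\<close>, where every positive
  power of \<open>mob a\<close> vanishes.\<close>

lemma mob_basis_orthonormal:
  assumes a: "cmod a < 1"
  shows "ip (mob_basis a n) (mob_basis a m) = (if n = m then 1 else 0)"
proof -
  have d: "of_real (1 - (cmod a)\<^sup>2) \<noteq> (0 :: complex)"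
    using one_minus_norm_sq_pos[OF a] by (metis less_irrefl of_real_eq_0_iff)
  have *: "ip (mob_basis a (k + m)) (mob_basis a m) = (if k = 0 then 1 else 0)" for k m
  proof -
    have "ip (mob_basis a (k + m)) (mob_basis a m)
        = of_real (1 - (cmod a)\<^sup>2) * ip ((mob_mult a ^^ m) ((mob_mult a ^^ k) (ker a))) ((mob_mult a ^^ m) (ker a))"
      unfolding mob_basis_def ip_csc_left ip_csc_right cnj_mob_scale mult.assoc[symmetric]
        mob_scale_sq[OF a] by (simp add: funpow_add add.commute[of k m])
    also have "\<dots> = of_real (1 - (cmod a)\<^sup>2) * ev ((mob_mult a ^^ k) (ker a)) a"
      by (simp only: ip_mob_mult_pow[OF a] ev_eq_ip[OF a])
    also have "\<dots> = (if k = 0 then 1 else 0)"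
      using d complex_norm_square[of a]
      by (simp add: ev_mob_mult_pow a ev_ker mult.commute)
    finally show ?thesis .
  qed
  show ?thesis
  proof (cases "m \<le> n")
    case True
    then show ?thesis using *[of "n - m" m] by auto
  next
    case False
    then show ?thesis using *[of "m - n" n] cnj_ip[of "mob_basis a m" "mob_basis a n"] by auto
  qed
qed

text \<open>The unitary involution \<open>f \<mapsto> mob_scale a / (1 - cnj a z) * f (mob a z)\<close>.\<close>

definition mob_unitary :: "complex \<Rightarrow> ell2 \<Rightarrow> ell2" where
  "mob_unitary a x = (\<Sum>n. csc (coord x n) (mob_basis a n))"

lemma ev_mob_unitary:
  assumes "cmod a < 1" "cmod z < 1"
  shows "ev (mob_unitary a x) z = mob_scale a / (1 - cnj a * z) * ev x (mob a z)"
proof -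
  have "(\<lambda>n. csc (coord x n) (mob_basis a n)) sums mob_unitary a x"
    unfolding mob_unitary_def
    by (intro summable_sums orthonormal_series mob_basis_orthonormal assms summable_coord)
  then have "(\<lambda>n. ip (csc (coord x n) (mob_basis a n)) (ker z)) sums ip (mob_unitary a x) (ker z)"
    by (rule bounded_linear.sums[OF bounded_linear_ip_left])
  then have "(\<lambda>n. coord x n * ev (mob_basis a n) z) sums ev (mob_unitary a x) z"
    using assms by (simp add: ev_eq_ip ip_simps)
  moreover have "(\<lambda>n. mob_scale a / (1 - cnj a * z) * (coord x n * mob a z ^ n)) sums
      (mob_scale a / (1 - cnj a * z) * ev x (mob a z))"
    by (intro sums_mult ev_sums norm_mob assms)
  ultimately show ?thesis
    by (simp add: ev_mob_basis assms mult_ac sums_iff)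
qed

lemma ip_mob_unitary:
  assumes a: "cmod a < 1"
  shows "ip (mob_unitary a x) (mob_unitary a y) = ip x y"
proof (rule isometry_imp_ip)
  show "mob_unitary a (x + y) = mob_unitary a x + mob_unitary a y" for x y
    by (rule ev_inject) (simp add: ev_mob_unitary a ev_simps algebra_simps add_divide_distrib)
  show "mob_unitary a (csc c x) = csc c (mob_unitary a x)" for c x
    by (rule ev_inject) (simp add: ev_mob_unitary a ev_simps)
  have "(norm (mob_unitary a x))\<^sup>2 = (norm x)\<^sup>2" for x
    unfolding mob_unitary_def norm_sq_ell2[of x]
    by (intro orthonormal_series mob_basis_orthonormal a summable_coord)
  then show "norm (mob_unitary a x) = norm x" for x
    by simp
qed

lemma mob_unitary_mob_unitary:
  assumes a: "cmod a < 1"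
  shows "mob_unitary a (mob_unitary a x) = x"
proof (rule ev_inject)
  fix z :: complex assume z: "cmod z < 1"
  have "of_real (1 - (cmod a)\<^sup>2) \<noteq> (0 :: complex)"
    using one_minus_norm_sq_pos[OF a] by (metis less_irrefl of_real_eq_0_iff)
  moreover have "ev (mob_unitary a (mob_unitary a x)) z
      = mob_scale a * mob_scale a / of_real (1 - (cmod a)\<^sup>2) * ev x z"
    using one_minus_cnj_mult_neq_0[OF a z]
    by (simp add: ev_mob_unitary a z norm_mob mob_mob one_minus_cnj_mult_mob del: of_real_diff)
  ultimately show "ev (mob_unitary a (mob_unitary a x)) z = ev x z"
    unfolding mob_scale_sq[OF a] by simp
qed

lemma mob_unitary_self_adjoint:
  assumes a: "cmod a < 1"
  shows "ip (mob_unitary a x) y = ip x (mob_unitary a y)"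
  using ip_mob_unitary[OF a, of x "mob_unitary a y"] by (simp add: mob_unitary_mob_unitary a)

section \<open>Composition with \<open>mob a\<close> and its adjoint\<close>

definition comp_mob :: "complex \<Rightarrow> ell2 \<Rightarrow> ell2" where
  "comp_mob a x = csc (1 / mob_scale a) (mob_unitary a x - csc (cnj a) (shift (mob_unitary a x)))"

text \<open>The factors of \<open>comp_mob\<close> in reverse order: the shift turns into
  \<open>bshift\<close>, \<open>cnj a\<close> into \<open>a\<close>, and the unitary involution is
  self-adjoint.\<close>

definition comp_mob_adj :: "complex \<Rightarrow> ell2 \<Rightarrow> ell2" where
  "comp_mob_adj a x = csc (1 / mob_scale a) (mob_unitary a (x - csc a (bshift x)))"

text \<open>Multiplication by \<open>(1 - cnj a * z) / mob_scale a\<close> cancels the weight of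
  \<open>mob_unitary a\<close>, leaving pure composition.\<close>

lemma ev_comp_mob:
  assumes a: "cmod a < 1" and z: "cmod z < 1"
  shows "ev (comp_mob a x) z = ev x (mob a z)"
proof -
  have *: "1 / s * (s / d * e - cnj a * (z * (s / d * e))) = (1 - cnj a * z) / d * e"
    if "s \<noteq> 0" "d \<noteq> 0" for s d e :: complex
    using that by (simp add: field_simps)
  show ?thesis
    using one_minus_cnj_mult_neq_0[OF a z]
    by (simp add: comp_mob_def ev_simps ev_shift ev_mob_unitary a z * mob_scale_neq_0 del: times_divide_eq_left)
qed

lemma ip_comp_mob:
  assumes a: "cmod a < 1"
  shows "ip (comp_mob a x) y = ip x (comp_mob_adj a y)"
proof -
  have "ip (comp_mob a x) y = 1 / mob_scale a * ip (mob_unitary a x) (y - csc a (bshift y))"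
    by (simp add: comp_mob_def ip_simps ip_shift_left)
  then show ?thesis
    by (simp add: comp_mob_adj_def ip_csc_right mob_unitary_self_adjoint[OF a])
qed

lemma comp_mob_comp_mob:
  assumes a: "cmod a < 1"
  shows "comp_mob a (comp_mob a x) = x"
  by (rule ev_inject) (simp add: ev_comp_mob a norm_mob mob_mob)

lemma comp_mob_adj_comp_mob_adj:
  assumes a: "cmod a < 1"
  shows "comp_mob_adj a (comp_mob_adj a x) = x"
  by (rule ip_ext) (simp flip: ip_comp_mob[OF a] add: comp_mob_comp_mob a)

text \<open>The unitary factor drops out, so inner products of adjoint images are computed from
  Taylor coefficients alone. The comparison of eigenspaces in the elliptic case rests on
  this.\<close>

lemma ip_comp_mob_adj:
  assumes a: "cmod a < 1"
  shows "ip (comp_mob_adj a x) (comp_mob_adj a y)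
    = ip (x - csc a (bshift x)) (y - csc a (bshift y)) / of_real (1 - (cmod a)\<^sup>2)"
  unfolding comp_mob_adj_def ip_csc_left ip_csc_right ip_mob_unitary[OF a] mob_scale_sq[OF a, symmetric]
  by simp

lemma bounded_linear_comp_mob:
  assumes a: "cmod a < 1"
  shows "bounded_linear (comp_mob a)"
proof (rule bounded_linear_intro)
  show "comp_mob a (x + y) = comp_mob a x + comp_mob a y" for x y
    by (rule ev_inject) (simp add: ev_comp_mob a ev_simps)
  show "comp_mob a (r *\<^sub>R x) = r *\<^sub>R comp_mob a x" for r x
    unfolding csc_of_real[symmetric] by (rule ev_inject) (simp add: ev_comp_mob a ev_simps)
  show "norm (comp_mob a x) \<le> norm x * (cmod (1 / mob_scale a) * (1 + cmod a))" for x
  proof -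
    have u: "norm (mob_unitary a x) = norm x" for x
      using ip_mob_unitary[OF a, of x x] by (simp add: ip_self flip: of_real_power)
    have "norm (mob_unitary a x - csc (cnj a) (shift (mob_unitary a x))) \<le> norm x + cmod a * norm x"
      by (rule norm_triangle_le_diff) (simp add: u)
    then have "cmod (1 / mob_scale a) * norm (mob_unitary a x - csc (cnj a) (shift (mob_unitary a x)))
        \<le> cmod (1 / mob_scale a) * (norm x + cmod a * norm x)"
      by (rule mult_left_mono) simp
    then show ?thesis
      unfolding comp_mob_def norm_csc by (simp add: algebra_simps)
  qed
qed

lemma bounded_linear_adjoint:
  assumes T: "bounded_linear T" and S: "\<And>x y. ip (T x) y = ip x (S y)"
  shows "bounded_linear S"
proof -
  obtain K where K: "\<And>x. norm (T x) \<le> norm x * K"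
    using bounded_linear.bounded[OF T] by blast
  show ?thesis
  proof (rule bounded_linear_intro[where K = K])
    show "S (x + y) = S x + S y" for x y
      by (rule ip_ext) (simp add: ip_simps flip: S)
    show "S (r *\<^sub>R x) = r *\<^sub>R S x" for r x
      by (rule ip_ext) (simp add: ip_simps flip: S csc_of_real)
    show "norm (S x) \<le> norm x * K" for x
    proof (cases "S x = 0")
      case False
      have "(norm (S x))\<^sup>2 = cmod (ip (S x) (S x))" by (simp add: ip_self norm_power)
      also have "\<dots> = cmod (ip (T (S x)) x)" by (simp add: S)
      also have "\<dots> \<le> norm (S x) * K * norm x"
        by (rule order_trans[OF ip_Cauchy_Schwarz]) (simp add: K mult_right_mono)
      finally have "norm (S x) * norm (S x) \<le> norm (S x) * (norm x * K)"
        by (simp add: power2_eq_square mult_ac)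
      then show ?thesis using False by simp
    next
      case True
      have "0 \<le> norm x * K" using K[of x] norm_ge_zero order_trans by blast
      then show ?thesis using True by simp
    qed
  qed
qed

section \<open>The inverse square root of a positive operator\<close>

text \<open>The Taylor coefficients of \<open>(1 - x) powr (-1/2)\<close> at 0.\<close>

definition inv_sqrt_coeff :: "nat \<Rightarrow> real" where
  "inv_sqrt_coeff n = pochhammer (1 / 2) n / fact n"

text \<open>The square of \<open>(1 - x) powr (-1/2)\<close> is the geometric series; in
  coefficients this is Vandermonde's identity for the exponents -1/2 and -1/2.\<close>

lemma inv_sqrt_coeff_convolution: "(\<Sum>k\<le>n. inv_sqrt_coeff k * inv_sqrt_coeff (n - k)) = 1"
proof -
  have d: "inv_sqrt_coeff k = (- 1) ^ k * ((- 1 / 2) gchoose k)" for k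
    by (simp add: gbinomial_pochhammer inv_sqrt_coeff_def flip: power_mult_distrib)
  have "(\<Sum>k\<le>n. inv_sqrt_coeff k * inv_sqrt_coeff (n - k))
      = (\<Sum>k\<le>n. (- 1) ^ n * (((- 1 / 2) gchoose k) * ((- 1 / 2) gchoose (n - k))))"
  proof (intro sum.cong refl)
    fix k assume "k \<in> {..n}"
    then have "(- 1 :: real) ^ n = (- 1) ^ k * (- 1) ^ (n - k)" by (simp flip: power_add)
    then show "inv_sqrt_coeff k * inv_sqrt_coeff (n - k)
        = (- 1) ^ n * (((- 1 / 2) gchoose k) * ((- 1 / 2) gchoose (n - k)))"
      unfolding d by simp
  qed
  also have "\<dots> = (- 1) ^ n * ((- 1 / 2 + - 1 / 2) gchoose n)"
    unfolding sum_distrib_left[symmetric] gbinomial_Vandermonde[symmetric] by (simp add: atMost_atLeast0)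
  also have "\<dots> = pochhammer 1 n / fact n"
    by (simp add: gbinomial_pochhammer flip: power_mult_distrib)
  finally show ?thesis by (simp flip: pochhammer_fact)
qed

lemma inv_sqrt_coeff_nonneg: "inv_sqrt_coeff n \<ge> 0"
  by (simp add: inv_sqrt_coeff_def pochhammer_nonneg)

text \<open>The coefficient is one of the nonnegative terms of a convolution sum equal to 1.\<close>

lemma inv_sqrt_coeff_le_1: "inv_sqrt_coeff n \<le> 1"
proof -
  have "inv_sqrt_coeff 0 * inv_sqrt_coeff (n - 0) \<le> (\<Sum>k\<le>n. inv_sqrt_coeff k * inv_sqrt_coeff (n - k))"
    by (rule member_le_sum) (auto simp: inv_sqrt_coeff_nonneg)
  then show ?thesis by (simp add: inv_sqrt_coeff_convolution) (simp add: inv_sqrt_coeff_def)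
qed

text \<open>The dominating double series that justifies rearranging the product of two binomial
  series.\<close>

lemma geometric_abs_summable_on_prod:
  fixes \<rho> :: real
  assumes "0 \<le> \<rho>" "\<rho> < 1"
  shows "(\<lambda>p. norm (case p of (i, j) \<Rightarrow> \<rho> ^ i * \<rho> ^ j * c)) summable_on (UNIV :: (nat \<times> nat) set)"
proof -
  have g: "(\<lambda>n. \<rho> ^ n) summable_on (UNIV :: nat set)"
    by (rule norm_summable_imp_summable_on) (use assms in \<open>simp add: summable_geometric\<close>)
  have "(\<lambda>p. norm (case p of (i, j) \<Rightarrow> \<rho> ^ i * \<rho> ^ j * c))
      summable_on (SIGMA i:(UNIV :: nat set). (UNIV :: nat set))"
  proof (subst Infinite_Sum.abs_summable_on_Sigma_iff, intro conjI ballI)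
    fix i :: nat
    have "(\<lambda>j. (\<rho> ^ i * \<bar>c\<bar>) * \<rho> ^ j) summable_on (UNIV :: nat set)"
      by (intro summable_on_cmult_right g)
    then show "(\<lambda>j. norm (case (i, j) of (i, j) \<Rightarrow> \<rho> ^ i * \<rho> ^ j * c)) summable_on (UNIV :: nat set)"
      using assms by (simp add: abs_mult mult_ac)
  next
    have eq: "(\<Sum>\<^sub>\<infinity>j. norm (case (i, j) of (i, j) \<Rightarrow> \<rho> ^ i * \<rho> ^ j * c))
        = (\<bar>c\<bar> * (\<Sum>\<^sub>\<infinity>j. \<rho> ^ j)) * \<rho> ^ i" for i
      using infsum_cmult_right'[of "\<rho> ^ i * \<bar>c\<bar>" "\<lambda>j. \<rho> ^ j" UNIV] assms
      by (simp add: abs_mult mult_ac)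
    have "(\<lambda>i. \<bar>\<bar>c\<bar> * (\<Sum>\<^sub>\<infinity>j. \<rho> ^ j)\<bar> * \<rho> ^ i) summable_on (UNIV :: nat set)"
      by (intro summable_on_cmult_right g)
    then show "(\<lambda>i. norm (\<Sum>\<^sub>\<infinity>j. norm (case (i, j) of (i, j) \<Rightarrow> \<rho> ^ i * \<rho> ^ j * c)))
        summable_on (UNIV :: nat set)"
      unfolding eq using assms by (simp add: abs_mult)
  qed
  then show ?thesis by simp
qed

section \<open>Binomial series of a self-adjoint strict contraction\<close>

locale contraction =
  fixes X :: "'a::{real_inner, banach} \<Rightarrow> 'a" and \<rho> :: real
  assumes bl: "bounded_linear X"
    and \<rho>: "0 \<le> \<rho>" "\<rho> < 1"
    and norm_X: "norm (X x) \<le> \<rho> * norm x"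
    and self_adjoint: "inner (X x) y = inner x (X y)"
begin

lemma norm_X_pow: "norm ((X ^^ n) x) \<le> \<rho> ^ n * norm x"
proof (induction n)
  case (Suc n)
  have "norm (X ((X ^^ n) x)) \<le> \<rho> * norm ((X ^^ n) x)" by (rule norm_X)
  also have "\<dots> \<le> \<rho> * (\<rho> ^ n * norm x)" by (intro mult_left_mono Suc \<rho>)
  finally show ?case by (simp add: mult_ac)
qed simp

lemma bounded_linear_X_pow: "bounded_linear (X ^^ n)"
proof (induction n)
  case 0
  then show ?case using bounded_linear_ident by (simp add: id_def)
next
  case (Suc n)
  then show ?case using bounded_linear_compose[OF bl Suc] by (simp add: o_def)
qed

text \<open>The operator \<open>1 - X\<close> raised to the power -1/2.\<close>

definition G :: "'a \<Rightarrow> 'a" where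
  "G x = (\<Sum>n. inv_sqrt_coeff n *\<^sub>R (X ^^ n) x)"

lemma norm_coeff_le: "norm (inv_sqrt_coeff n *\<^sub>R (X ^^ m) x) \<le> \<rho> ^ m * norm x"
proof -
  have "norm (inv_sqrt_coeff n *\<^sub>R (X ^^ m) x) \<le> 1 * norm ((X ^^ m) x)"
    unfolding norm_scaleR
    by (intro mult_right_mono) (simp_all add: inv_sqrt_coeff_nonneg inv_sqrt_coeff_le_1)
  also have "\<dots> \<le> \<rho> ^ m * norm x" using norm_X_pow by simp
  finally show ?thesis .
qed

lemma summable_geo: "summable (\<lambda>n. \<rho> ^ n * norm (x :: 'a))"
  using \<rho> by (intro summable_mult2 summable_geometric) simp

lemma summable_norm_G: "summable (\<lambda>n. norm (inv_sqrt_coeff n *\<^sub>R (X ^^ n) x))"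
  by (rule summable_comparison_test'[OF summable_geo[of x]]) (simp add: norm_coeff_le del: norm_scaleR)

lemma summable_norm_X_pow: "summable (\<lambda>n. norm ((X ^^ n) x))"
  by (rule summable_comparison_test'[OF summable_geo[of x]]) (simp add: norm_X_pow)

lemma G_sums: "(\<lambda>n. inv_sqrt_coeff n *\<^sub>R (X ^^ n) x) sums G x"
  unfolding G_def by (rule summable_sums[OF summable_norm_cancel[OF summable_norm_G]])

text \<open>A bounded real-linear \<open>Y\<close> passes through the series term by term; over a
  complex space this includes conjugate-linear maps.\<close>

lemma G_commute:
  assumes Y: "bounded_linear Y" and XY: "\<And>x. Y (X x) = X (Y x)"
  shows "Y (G x) = G (Y x)"
proof -
  have pow: "Y ((X ^^ n) x) = (X ^^ n) (Y x)" for n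
    by (induction n) (simp_all add: XY)
  have "(\<lambda>n. inv_sqrt_coeff n *\<^sub>R (X ^^ n) (Y x)) sums Y (G x)"
    using bounded_linear.sums[OF Y G_sums[of x]]
    by (simp add: linear_scale[OF bounded_linear.linear[OF Y]] pow)
  then show ?thesis by (rule sums_unique2[OF _ G_sums])
qed

lemma inner_G: "inner (G x) y = inner x (G y)"
proof -
  have pow: "inner ((X ^^ n) x) y = inner x ((X ^^ n) y)" for n
    by (induction n arbitrary: y) (simp_all add: self_adjoint flip: funpow_swap1)
  have *: "inner (inv_sqrt_coeff n *\<^sub>R (X ^^ n) x) y = inner x (inv_sqrt_coeff n *\<^sub>R (X ^^ n) y)" for n
    by (simp add: pow)
  have "(\<lambda>n. inner (inv_sqrt_coeff n *\<^sub>R (X ^^ n) x) y) sums inner (G x) y"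
    by (rule bounded_linear.sums[OF bounded_linear_inner_left G_sums])
  moreover have "(\<lambda>n. inner x (inv_sqrt_coeff n *\<^sub>R (X ^^ n) y)) sums inner x (G y)"
    by (rule bounded_linear.sums[OF bounded_linear_inner_right G_sums])
  ultimately show ?thesis unfolding * by (rule sums_unique2)
qed

text \<open>Summed by rows the double series is \<open>G (G x)\<close>; summed along antidiagonals
  its coefficients convolve to 1, which leaves the Neumann series.\<close>

lemma G_G: "(\<lambda>n. (X ^^ n) x) sums G (G x)"
proof -
  define f where "f = (\<lambda>(i, j). (inv_sqrt_coeff i * inv_sqrt_coeff j) *\<^sub>R (X ^^ (i + j)) x)"
  have "(\<lambda>p. norm (f p)) summable_on UNIV"
  proof (rule Infinite_Sum.abs_summable_on_comparison_test[OF geometric_abs_summable_on_prod[OF \<rho>, of "norm x"]])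
    fix p :: "nat \<times> nat"
    obtain i j where p: "p = (i, j)" by (cases p)
    have "norm (f p) = inv_sqrt_coeff j * norm (inv_sqrt_coeff i *\<^sub>R (X ^^ (i + j)) x)"
      by (simp add: f_def p inv_sqrt_coeff_nonneg abs_mult)
    also have "\<dots> \<le> 1 * (\<rho> ^ (i + j) * norm x)"
      by (intro mult_mono norm_coeff_le) (simp_all add: inv_sqrt_coeff_nonneg inv_sqrt_coeff_le_1)
    finally show "norm (f p) \<le> norm (case p of (i, j) \<Rightarrow> \<rho> ^ i * \<rho> ^ j * norm x)"
      using \<rho> by (simp add: p power_add)
  qed
  then have f: "f summable_on UNIV" by (rule abs_summable_summable)
  have to_inf: "S = infsum g (UNIV :: nat set)" if "summable (\<lambda>n. norm (g n))" "g sums S"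
    for S :: 'a and g :: "nat \<Rightarrow> 'a"
    using norm_summable_imp_has_sum[OF that] by (simp add: infsumI)
  have row: "(\<Sum>\<^sub>\<infinity>j. f (i, j)) = inv_sqrt_coeff i *\<^sub>R (X ^^ i) (G x)" for i
  proof -
    have "inv_sqrt_coeff j *\<^sub>R (X ^^ (i + j)) x = (X ^^ i) (inv_sqrt_coeff j *\<^sub>R (X ^^ j) x)" for j
      by (simp add: funpow_add linear_scale[OF bounded_linear.linear[OF bounded_linear_X_pow]])
    then have f_row: "f (i, j) = inv_sqrt_coeff i *\<^sub>R (X ^^ i) (inv_sqrt_coeff j *\<^sub>R (X ^^ j) x)" for j
      by (simp add: f_def flip: scaleR_scaleR)
    have "summable (\<lambda>j. norm (f (i, j)))"
    proof (rule summable_comparison_test'[OF summable_geo[of x]])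
      fix j
      have "norm (f (i, j)) \<le> \<rho> ^ i * norm (inv_sqrt_coeff j *\<^sub>R (X ^^ j) x)"
        unfolding f_row by (rule norm_coeff_le)
      also have "\<dots> \<le> 1 * (\<rho> ^ j * norm x)"
        using \<rho> by (intro mult_mono norm_coeff_le) (auto simp: power_le_one)
      finally show "norm (norm (f (i, j))) \<le> \<rho> ^ j * norm x" by simp
    qed
    moreover have "(\<lambda>j. f (i, j)) sums (inv_sqrt_coeff i *\<^sub>R (X ^^ i) (G x))"
      unfolding f_row
      by (intro sums_scaleR_right bounded_linear.sums[OF bounded_linear_X_pow] G_sums)
    ultimately show ?thesis by (rule to_inf[symmetric])
  qed
  have "infsum f UNIV = (\<Sum>\<^sub>\<infinity>i. \<Sum>\<^sub>\<infinity>j. f (i, j))"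
    using infsum_Sigma_banach[of f UNIV "\<lambda>_. UNIV"] f by simp
  also have "\<dots> = G (G x)"
    unfolding row by (rule to_inf[symmetric, OF summable_norm_G G_sums])
  finally have 1: "infsum f UNIV = G (G x)" .
  \<comment> \<open>The pair \<open>(n, k)\<close> names the term \<open>i = k\<close>,
    \<open>j = n - k\<close> on the antidiagonal \<open>i + j = n\<close>.\<close>
  define h :: "nat \<times> nat \<Rightarrow> nat \<times> nat" where "h = (\<lambda>(n, k). (k, n - k))"
  have bij: "bij_betw h (SIGMA n:UNIV. {..n}) UNIV"
    by (rule bij_betw_byWitness[where f' = "\<lambda>(i, j). (i + j, i)"]) (auto simp: h_def)
  have "infsum f UNIV = infsum (\<lambda>p. f (h p)) (SIGMA n:UNIV. {..n})"
    by (rule infsum_reindex_bij_betw[OF bij, symmetric])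
  also have "\<dots> = (\<Sum>\<^sub>\<infinity>n. \<Sum>\<^sub>\<infinity>k\<in>{..n}. f (h (n, k)))"
    by (rule infsum_Sigma_banach[symmetric]) (simp add: summable_on_reindex_bij_betw[OF bij] f)
  also have "\<dots> = (\<Sum>\<^sub>\<infinity>n. (X ^^ n) x)"
    by (simp add: h_def f_def inv_sqrt_coeff_convolution flip: scaleR_sum_left)
  finally have "G (G x) = (\<Sum>\<^sub>\<infinity>n. (X ^^ n) x)" using 1 by simp
  moreover have "(\<lambda>n. (X ^^ n) x) sums suminf (\<lambda>n. (X ^^ n) x)"
    by (rule summable_sums[OF summable_norm_cancel[OF summable_norm_X_pow]])
  ultimately show ?thesis using to_inf[OF summable_norm_X_pow, of x] by simp
qed

text \<open>The Neumann series applied to \<open>x - X x\<close> telescopes to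
  \<open>x\<close>.\<close>

lemma G_G_one_minus: "G (G (x - X x)) = x"
proof -
  have lim: "(\<lambda>n. (X ^^ n) x) \<longlonglongrightarrow> 0"
    by (rule summable_LIMSEQ_zero[OF summable_norm_cancel[OF summable_norm_X_pow]])
  have "(X ^^ n) (x - X x) = (X ^^ n) x - (X ^^ Suc n) x" for n
    by (simp add: linear_diff[OF bounded_linear.linear[OF bounded_linear_X_pow]] funpow_swap1)
  moreover have "(\<lambda>n. (X ^^ n) x - (X ^^ Suc n) x) sums ((X ^^ 0) x - 0)"
    by (rule telescope_sums'[OF lim])
  ultimately have "(\<lambda>n. (X ^^ n) (x - X x)) sums x" by simp
  then show ?thesis by (rule sums_unique2[OF G_G])
qed

end

text \<open>\<open>K\<close> is the inverse square root of \<open>L \<circ> L\<close>. Scaled by an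
  upper bound \<open>B\<^sup>2\<close>, the operator \<open>L \<circ> L\<close> is the identity
  minus a self-adjoint \<open>X\<close>; expanding the square of \<open>norm (X x)\<close> and using
  both bounds on \<open>L\<close> yields the contraction factor \<open>\<rho>\<close>.\<close>

lemma inverse_sqrt_of_square:
  fixes L :: "'a::{real_inner, banach} \<Rightarrow> 'a"
  assumes L: "bounded_linear L" and sa: "\<And>x y. inner (L x) y = inner x (L y)"
    and lower: "\<And>x. \<delta> * (norm x)\<^sup>2 \<le> (norm (L x))\<^sup>2" and "\<delta> > 0"
  obtains K where "\<And>x y. inner (K x) y = inner x (K y)" "\<And>x. K (K (L (L x))) = x"
    "\<And>Y x. bounded_linear Y \<Longrightarrow> (\<And>x. Y (L (L x)) = L (L (Y x))) \<Longrightarrow> Y (K x) = K (Y x)"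
proof -
  obtain B0 where B0: "B0 > 0" "\<And>x. norm (L x) \<le> norm x * B0"
    using bounded_linear.pos_bounded[OF L] by blast
  \<comment> \<open>The summand \<open>sqrt \<delta>\<close> secures
    \<open>\<delta> \<le> B\<^sup>2\<close> even on the zero space, where the bound
    \<open>B0\<close> may be arbitrarily small.\<close>
  define B where "B = B0 + sqrt \<delta>"
  have B: "B > 0" using B0 \<open>\<delta> > 0\<close> by (simp add: B_def add_pos_pos)
  have norm_L: "norm (L x) \<le> norm x * B" for x
  proof -
    have "norm x * B0 \<le> norm x * B" using \<open>\<delta> > 0\<close> by (intro mult_left_mono) (auto simp: B_def)
    then show ?thesis using B0(2)[of x] by simp
  qed
  have "(sqrt \<delta>)\<^sup>2 \<le> B\<^sup>2"
    using B0 \<open>\<delta> > 0\<close> by (intro power_mono) (auto simp: B_def)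
  then have \<delta>B: "\<delta> \<le> B\<^sup>2" using \<open>\<delta> > 0\<close> by simp
  define X where "X x = x - (1 / B\<^sup>2) *\<^sub>R L (L x)" for x
  define \<rho> where "\<rho> = sqrt (1 - \<delta> / B\<^sup>2)"
  interpret contraction X \<rho>
  proof (rule contraction.intro)
    show "bounded_linear X"
      unfolding X_def
      by (rule bounded_linear_sub[OF bounded_linear_ident
            bounded_linear_compose[OF bounded_linear_scaleR_right bounded_linear_compose[OF L L]]])
    show "0 \<le> \<rho>" using \<delta>B B by (simp add: \<rho>_def)
    show "\<rho> < 1" using \<open>\<delta> > 0\<close> B by (simp add: \<rho>_def)
    show "inner (X x) y = inner x (X y)" for x y :: 'a
    proof -
      have "inner (L (L x)) y = inner x (L (L y))" by (simp only: sa)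
      then show ?thesis by (simp add: X_def inner_diff_left inner_diff_right)
    qed
    show "norm (X x) \<le> \<rho> * norm x" for x
    proof (rule power2_le_imp_le)
      define c where "c = 1 / B\<^sup>2"
      have sq: "(norm (x - c *\<^sub>R p))\<^sup>2 = (norm x)\<^sup>2 - 2 * c * inner x p + c * c * (norm p)\<^sup>2" for p
        unfolding power2_norm_eq_inner
        by (simp add: inner_diff_left inner_diff_right inner_commute algebra_simps)
      have "inner x (L (L x)) = (norm (L x))\<^sup>2" by (simp only: power2_norm_eq_inner sa)
      moreover have "X x = x - c *\<^sub>R L (L x)" by (simp only: X_def c_def)
      ultimately have "(norm (X x))\<^sup>2 = (norm x)\<^sup>2 - 2 * c * (norm (L x))\<^sup>2 + c * c * (norm (L (L x)))\<^sup>2"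
        by (simp only: sq)
      also have "\<dots> \<le> (norm x)\<^sup>2 - 2 * c * (norm (L x))\<^sup>2 + c * c * (norm (L x) * B)\<^sup>2"
        by (intro add_left_mono mult_left_mono power_mono norm_L) auto
      also have "\<dots> = (norm x)\<^sup>2 - (norm (L x))\<^sup>2 / B\<^sup>2"
      proof -
        have "c * c * (norm (L x) * B)\<^sup>2 = c * (norm (L x))\<^sup>2"
          using B by (simp add: c_def power_mult_distrib power2_eq_square)
        then show ?thesis by (simp add: c_def)
      qed
      also have "\<dots> \<le> (norm x)\<^sup>2 - \<delta> * (norm x)\<^sup>2 / B\<^sup>2"
        by (intro diff_left_mono divide_right_mono lower) auto
      also have "\<dots> = (\<rho> * norm x)\<^sup>2"
        using \<delta>B B by (simp add: \<rho>_def power_mult_distrib left_diff_distrib)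
      finally show "(norm (X x))\<^sup>2 \<le> (\<rho> * norm x)\<^sup>2" .
      show "0 \<le> \<rho> * norm x" using \<delta>B B by (simp add: \<rho>_def)
    qed
  qed
  have LL: "L (L x) = B\<^sup>2 *\<^sub>R (x - X x)" for x
    using B by (simp add: X_def)
  have G_scale: "G (r *\<^sub>R x) = r *\<^sub>R G x" for r x
    by (rule G_commute[symmetric, OF bounded_linear_scaleR_right])
      (simp add: linear_scale[OF bounded_linear.linear[OF bl]])
  show ?thesis
  proof (rule that[of "\<lambda>x. (1 / B) *\<^sub>R G x"])
    show "inner ((1 / B) *\<^sub>R G x) y = inner x ((1 / B) *\<^sub>R G y)" for x y
      by (simp add: inner_G)
    show "(1 / B) *\<^sub>R G ((1 / B) *\<^sub>R G (L (L x))) = x" for x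
      unfolding LL G_scale G_G_one_minus using B by (simp add: power2_eq_square)
    show "Y ((1 / B) *\<^sub>R G x) = (1 / B) *\<^sub>R G (Y x)"
      if Y: "bounded_linear Y" and "\<And>x. Y (L (L x)) = L (L (Y x))" for Y x
    proof -
      have "Y (X x) = X (Y x)" for x
        using that by (simp add: X_def linear_diff linear_scale bounded_linear.linear)
      then show ?thesis
        by (simp add: linear_scale[OF bounded_linear.linear[OF Y]] G_commute[OF Y])
    qed
  qed
qed

section \<open>Complex symmetric composition operators\<close>

definition antiunitary_involution :: "(ell2 \<Rightarrow> ell2) \<Rightarrow> bool" where
  "antiunitary_involution C \<longleftrightarrow>
     (\<forall>x y. C (x + y) = C x + C y) \<and> (\<forall>c x. C (csc c x) = csc (cnj c) (C x)) \<and>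
     (\<forall>x y. ip (C x) (C y) = ip y x) \<and> (\<forall>x. C (C x) = x)"

lemma antiunitary_involutionD:
  assumes "antiunitary_involution C"
  shows "C (x + y) = C x + C y" "C (csc c x) = csc (cnj c) (C x)" "ip (C x) (C y) = ip y x"
    "C (C x) = x" "norm (C x) = norm x"
proof -
  show 1: "C (x + y) = C x + C y" "C (csc c x) = csc (cnj c) (C x)" "ip (C x) (C y) = ip y x"
    "C (C x) = x"
    using assms by (simp_all add: antiunitary_involution_def)
  have "ip (C x) (C x) = ip x x"
    using assms by (simp add: antiunitary_involution_def)
  then show "norm (C x) = norm x" by (simp add: ip_self flip: of_real_power)
qed

lemma ev_plus: "ev x + ev y = ev (x + y)"
  by (rule ext) (simp add: ev_add)

lemma fun_scale_ev: "fun_scale c (ev x) = ev (csc c x)"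
  by (rule ext) (simp add: ev_csc fun_scale_def)

lemma hardy_space_eq_range: "hardy_space = range ev"
  using hardy_ev_surj ev_in_hardy by blast

text \<open>\<open>ev\<close> is a unitary isomorphism onto \<open>hardy_space\<close>, so
  conjugations and adjoints transport both ways. The remaining argument takes place on the type
  \<open>ell2\<close>, free of carrier sets.\<close>

lemma complex_symmetric_composition_iff:
  assumes T: "\<And>x z. cmod z < 1 \<Longrightarrow> ev (T x) z = ev x (\<phi> z)"
    and bd: "\<And>x. norm (T x) \<le> K * norm x"
  shows "complex_symmetric hardy_space fun_scale hardy_inner (composition_operator \<phi>) \<longleftrightarrow>
    (\<exists>C S. antiunitary_involution C \<and> (\<forall>x y. ip (T x) y = ip x (S y)) \<and> (\<forall>x. T x = C (S (C x))))"
    (is "?L \<longleftrightarrow> ?R")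
proof -
  have comp: "composition_operator \<phi> (ev x) = ev (T x)" for x
    by (rule ext) (auto simp: composition_operator_def T ev_outside)
  have inj: "ev x = ev y \<longleftrightarrow> x = y" for x y
    using coeffs_ev by metis
  show ?thesis
  proof
    assume ?L
    then obtain C S where C: "conjugation hardy_space fun_scale hardy_inner C"
      and S: "is_adjoint hardy_space hardy_inner (composition_operator \<phi>) S"
      and CS: "\<forall>x\<in>hardy_space. composition_operator \<phi> x = C (S (C x))"
      by (auto simp: complex_symmetric_def)
    have C_ev: "C (ev x) \<in> hardy_space" "C (ev x + ev y) = C (ev x) + C (ev y)"
      "C (fun_scale c (ev x)) = fun_scale (cnj c) (C (ev x))"
      "hardy_inner (C (ev x)) (C (ev y)) = hardy_inner (ev y) (ev x)" "C (C (ev x)) = ev x" for c x y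
      using C ev_in_hardy[of x] ev_in_hardy[of y] by (auto simp: conjugation_def)
    have S_ev: "S (ev x) \<in> hardy_space"
      "hardy_inner (composition_operator \<phi> (ev x)) (ev y) = hardy_inner (ev x) (S (ev y))" for x y
      using S ev_in_hardy[of x] ev_in_hardy[of y] by (auto simp: is_adjoint_def)
    define C' where "C' x = coeffs (C (ev x))" for x
    define S' where "S' x = coeffs (S (ev x))" for x
    have C': "ev (C' x) = C (ev x)" for x
      unfolding C'_def by (rule ev_coeffs[OF C_ev(1)])
    have S': "ev (S' x) = S (ev x)" for x
      unfolding S'_def by (rule ev_coeffs[OF S_ev(1)])
    have "antiunitary_involution C'"
      unfolding antiunitary_involution_def
    proof (intro conjI allI)
      show "C' (x + y) = C' x + C' y" for x y
        by (simp only: inj[symmetric] ev_plus[symmetric] C' C_ev)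
      show "C' (csc c x) = csc (cnj c) (C' x)" for c x
        by (simp only: inj[symmetric] fun_scale_ev[symmetric] C' C_ev)
      show "ip (C' x) (C' y) = ip y x" for x y
        by (simp only: hardy_inner_ev[symmetric] C' C_ev)
      show "C' (C' x) = x" for x
        by (simp only: inj[symmetric] C' C_ev)
    qed
    moreover have "ip (T x) y = ip x (S' y)" for x y
      by (simp only: hardy_inner_ev[symmetric] comp[symmetric] S' S_ev)
    moreover have "T x = C' (S' (C' x))" for x
      using CS ev_in_hardy[of x] by (simp add: inj[symmetric] comp[symmetric] C' S')
    ultimately show ?R by blast
  next
    assume ?R
    then obtain C S where C: "antiunitary_involution C"
      and S: "\<And>x y. ip (T x) y = ip x (S y)" and CS: "\<And>x. T x = C (S (C x))"
      by blast
    define C' where "C' f = ev (C (coeffs f))" for f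
    define S' where "S' f = ev (S (coeffs f))" for f
    have C': "C' (ev x) = ev (C x)" and S': "S' (ev x) = ev (S x)" for x
      by (simp_all add: C'_def S'_def coeffs_ev)
    have Tadd: "T (x + y) = T x + T y" and Tcsc: "T (csc c x) = csc c (T x)" for x y c
      by (rule ev_inject; simp add: T ev_simps)+
    have "bounded_operator hardy_space fun_scale hardy_inner (composition_operator \<phi>)"
      unfolding bounded_operator_def hardy_space_eq_range
      using bd by (auto simp: comp ev_plus fun_scale_ev Tadd Tcsc hardy_norm_inner ev_in_hardy hardy_norm_ev)
    moreover have "conjugation hardy_space fun_scale hardy_inner C'"
      unfolding conjugation_def hardy_space_eq_range
      by (auto simp: C' ev_plus fun_scale_ev hardy_inner_ev antiunitary_involutionD[OF C])
    moreover have "is_adjoint hardy_space hardy_inner (composition_operator \<phi>) S'"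
      unfolding is_adjoint_def hardy_space_eq_range by (auto simp: S' comp hardy_inner_ev S)
    moreover have "\<forall>f\<in>hardy_space. composition_operator \<phi> f = C' (S' (C' f))"
      unfolding hardy_space_eq_range by (auto simp: S' C' comp CS)
    ultimately show ?L unfolding complex_symmetric_def by blast
  qed
qed

subsection \<open>Automorphisms of the disk\<close>

text \<open>Schwarz's lemma for \<open>f\<close> and for its inverse gives equality of moduli at one
  nonzero point, and the equality case makes \<open>f\<close> a rotation.\<close>

lemma disk_inverse_pair_rotation:
  assumes f: "f holomorphic_on unit_disk" "\<And>z. cmod z < 1 \<Longrightarrow> cmod (f z) < 1" "f 0 = 0"
    and g: "g holomorphic_on unit_disk" "\<And>z. cmod z < 1 \<Longrightarrow> cmod (g z) < 1" "g 0 = 0"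
    and gf: "\<And>z. cmod z < 1 \<Longrightarrow> g (f z) = z"
  obtains l where "cmod l = 1" "\<And>z. cmod z < 1 \<Longrightarrow> f z = l * z"
proof -
  define w :: complex where "w = 1 / 2"
  have w: "cmod w < 1" "w \<noteq> 0" by (simp_all add: w_def norm_divide)
  have "cmod (f w) \<le> cmod w"
    by (rule Schwarz_Lemma(1)[OF f(1) f(3) f(2) w(1)])
  moreover have "cmod (g (f w)) \<le> cmod (f w)"
    by (rule Schwarz_Lemma(1)[OF g(1) g(3) g(2) f(2)[OF w(1)]])
  ultimately have "cmod (f w) = cmod w" using gf[OF w(1)] by simp
  then have "\<exists>l. (\<forall>z. cmod z < 1 \<longrightarrow> f z = l * z) \<and> cmod l = 1"
    using Schwarz_Lemma(3)[OF f(1) f(3) f(2) w(1)] w by blast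
  then show ?thesis using that by blast
qed

lemma disk_automorphismD:
  assumes "disk_automorphism \<phi>"
  defines "\<psi> \<equiv> inv_into unit_disk \<phi>"
  shows "\<phi> holomorphic_on unit_disk" "\<psi> holomorphic_on unit_disk"
    "cmod z < 1 \<Longrightarrow> cmod (\<phi> z) < 1" "cmod z < 1 \<Longrightarrow> cmod (\<psi> z) < 1"
    "cmod z < 1 \<Longrightarrow> \<psi> (\<phi> z) = z" "cmod z < 1 \<Longrightarrow> \<phi> (\<psi> z) = z"
proof -
  have b: "bij_betw \<phi> unit_disk unit_disk"
    and "\<phi> holomorphic_on unit_disk" "\<psi> holomorphic_on unit_disk"
    using assms by (simp_all add: disk_automorphism_def)
  then show "\<phi> holomorphic_on unit_disk" "\<psi> holomorphic_on unit_disk" by auto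
  have b': "bij_betw \<psi> unit_disk unit_disk" unfolding \<psi>_def by (rule bij_betw_inv_into[OF b])
  show "cmod z < 1 \<Longrightarrow> cmod (\<phi> z) < 1" using bij_betwE[OF b] by simp
  show "cmod z < 1 \<Longrightarrow> cmod (\<psi> z) < 1" using bij_betwE[OF b'] by simp
  show "cmod z < 1 \<Longrightarrow> \<psi> (\<phi> z) = z" unfolding \<psi>_def by (rule bij_betw_inv_into_left[OF b]) simp
  show "cmod z < 1 \<Longrightarrow> \<phi> (\<psi> z) = z" unfolding \<psi>_def by (rule bij_betw_inv_into_right[OF b]) simp
qed

lemma holomorphic_compose_disk:
  assumes "f holomorphic_on unit_disk" "g holomorphic_on unit_disk" "\<And>z. cmod z < 1 \<Longrightarrow> cmod (g z) < 1"
  shows "(\<lambda>z. f (g z)) holomorphic_on unit_disk"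
proof -
  have "f \<circ> g holomorphic_on unit_disk"
    by (rule holomorphic_on_compose_gen[OF assms(2,1)]) (use assms(3) in auto)
  then show ?thesis by (simp add: o_def)
qed

text \<open>For \<open>b\<close> the preimage of 0, the map \<open>\<phi> \<circ> mob b\<close> is
  an automorphism fixing 0, hence a rotation.\<close>

lemma disk_automorphism_form:
  assumes "disk_automorphism \<phi>"
  obtains u b where "cmod u = 1" "cmod b < 1" "\<And>z. cmod z < 1 \<Longrightarrow> \<phi> z = u * mob b z"
proof -
  define \<psi> where "\<psi> = inv_into unit_disk \<phi>"
  note \<phi> = disk_automorphismD[OF assms, folded \<psi>_def]
  define b where "b = \<psi> 0"
  have b: "cmod b < 1" "\<phi> b = 0" using \<phi>(4)[of 0] \<phi>(6)[of 0] by (simp_all add: b_def)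
  obtain u where u: "cmod u = 1" "\<And>z. cmod z < 1 \<Longrightarrow> \<phi> (mob b z) = u * z"
  proof (rule disk_inverse_pair_rotation[of "\<lambda>z. \<phi> (mob b z)" "\<lambda>z. mob b (\<psi> z)"])
    show "(\<lambda>z. \<phi> (mob b z)) holomorphic_on unit_disk"
      by (rule holomorphic_compose_disk[OF \<phi>(1) mob_holomorphic[OF b(1)] norm_mob[OF b(1)]])
    show "(\<lambda>z. mob b (\<psi> z)) holomorphic_on unit_disk"
      by (rule holomorphic_compose_disk[OF mob_holomorphic[OF b(1)] \<phi>(2) \<phi>(4)])
  qed (use b in \<open>auto simp: \<phi> norm_mob mob_mob b_def[symmetric]\<close>)
  have "\<phi> z = u * mob b z" if "cmod z < 1" for z
    using u(2)[of "mob b z"] that b by (simp add: norm_mob mob_mob)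
  with u(1) b(1) show ?thesis using that by blast
qed

text \<open>Conjugation by the involution \<open>mob a\<close> moves the fixed point to 0, where an
  automorphism is a rotation.\<close>

lemma disk_automorphism_fixpoint_form:
  assumes "disk_automorphism \<phi>" and a: "cmod a < 1" "\<phi> a = a"
  obtains l where "cmod l = 1" "\<And>z. cmod z < 1 \<Longrightarrow> \<phi> z = mob a (l * mob a z)"
proof -
  define \<psi> where "\<psi> = inv_into unit_disk \<phi>"
  note \<phi> = disk_automorphismD[OF assms(1), folded \<psi>_def]
  have "\<psi> a = a" using \<phi>(5)[OF a(1)] a(2) by simp
  obtain l where l: "cmod l = 1" "\<And>z. cmod z < 1 \<Longrightarrow> mob a (\<phi> (mob a z)) = l * z"
  proof (rule disk_inverse_pair_rotation[of "\<lambda>z. mob a (\<phi> (mob a z))" "\<lambda>z. mob a (\<psi> (mob a z))"])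
    show "(\<lambda>z. mob a (\<phi> (mob a z))) holomorphic_on unit_disk"
      by (rule holomorphic_compose_disk[OF mob_holomorphic[OF a(1)]
            holomorphic_compose_disk[OF \<phi>(1) mob_holomorphic[OF a(1)] norm_mob[OF a(1)]]
            \<phi>(3)[OF norm_mob[OF a(1)]]])
    show "(\<lambda>z. mob a (\<psi> (mob a z))) holomorphic_on unit_disk"
      by (rule holomorphic_compose_disk[OF mob_holomorphic[OF a(1)]
            holomorphic_compose_disk[OF \<phi>(2) mob_holomorphic[OF a(1)] norm_mob[OF a(1)]]
            \<phi>(4)[OF norm_mob[OF a(1)]]])
  qed (use a \<open>\<psi> a = a\<close> in \<open>auto simp: \<phi> norm_mob mob_mob\<close>)
  have "\<phi> z = mob a (l * mob a z)" if "cmod z < 1" for z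
    using l(2)[OF norm_mob[OF a(1) that]] mob_mob[OF a(1) \<phi>(3)[OF that]]
    by (simp add: mob_mob[OF a(1) that])
  with l(1) show ?thesis using that by blast
qed

subsection \<open>Sufficiency\<close>

text \<open>With \<open>W = comp_mob a\<close> and \<open>L = W + W\<^sup>*\<close>, the operator \<open>L\<^sup>2 = 2 + W W\<^sup>* + W\<^sup>* W\<close> commutes
  with \<open>W\<close>, so the sign \<open>N = L (L\<^sup>2)\<^sup>-\<^sup>1\<^sup>/\<^sup>2\<close> is a self-adjoint unitary with \<open>N W\<^sup>* N = W\<close>.\<close>

lemma comp_mob_sign:
  assumes a: "cmod a < 1"
  obtains N where "\<And>x y. N (x + y) = N x + N y" "\<And>c x. N (csc c x) = csc c (N x)"
    "\<And>x y. ip (N x) (N y) = ip x y" "\<And>x. N (N x) = x"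
    "\<And>x. N (comp_mob_adj a (N x)) = comp_mob a x"
    "\<And>Y x. bounded_linear Y \<Longrightarrow> (\<And>x. Y (comp_mob a x) = comp_mob a (Y x)) \<Longrightarrow>
       (\<And>x. Y (comp_mob_adj a x) = comp_mob_adj a (Y x)) \<Longrightarrow> Y (N x) = N (Y x)"
proof -
  define W where "W = comp_mob a"
  define V where "V = comp_mob_adj a"
  define L where "L x = W x + V x" for x
  have WV: "ip (W x) y = ip x (V y)" for x y
    unfolding W_def V_def by (rule ip_comp_mob[OF a])
  have VW: "ip (V x) y = ip x (W y)" for x y
    using WV[of y x] by (metis cnj_ip)
  have bW: "bounded_linear W" unfolding W_def by (rule bounded_linear_comp_mob[OF a])
  have bV: "bounded_linear V" by (rule bounded_linear_adjoint[OF bW WV])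
  have bL: "bounded_linear L" unfolding L_def by (rule bounded_linear_add[OF bW bV])
  have WW: "W (W x) = x" for x unfolding W_def by (rule comp_mob_comp_mob[OF a])
  have VV: "V (V x) = x" for x unfolding V_def by (rule comp_mob_adj_comp_mob_adj[OF a])
  have add: "W (x + y) = W x + W y" "V (x + y) = V x + V y" "L (x + y) = L x + L y" for x y
    by (rule linear_add[OF bounded_linear.linear], fact)+
  have sc: "W (csc c x) = csc c (W x)" for c x
    unfolding W_def by (rule ev_inject) (simp add: ev_comp_mob a ev_simps)
  have scV: "V (csc c x) = csc c (V x)" for c x
    by (rule ip_ext) (simp add: ip_csc_right flip: WV)
  have scL: "L (csc c x) = csc c (L x)" for c x
    by (simp add: L_def sc scV csc_add)
  have Lsa: "inner (L x) y = inner x (L y)" for x y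
    by (simp add: inner_eq_Re_ip L_def ip_simps WV VW)
  have lower: "2 * (norm x)\<^sup>2 \<le> (norm (L x))\<^sup>2" for x
  proof -
    \<comment> \<open>Moving \<open>V\<close> across turns it into a second \<open>W\<close>, and
      \<open>W\<close> is an involution. This cross term is the source of the lower bound 2.\<close>
    have "inner (W x) (V x) = inner x x" by (simp add: inner_eq_Re_ip WW flip: WV)
    then have "(norm (L x))\<^sup>2 = (norm (W x))\<^sup>2 + (norm (V x))\<^sup>2 + 2 * (norm x)\<^sup>2"
      unfolding power2_norm_eq_inner L_def
      by (simp add: inner_add_left inner_add_right inner_commute)
    then show ?thesis by simp
  qed
  obtain K where Ksa: "\<And>x y. inner (K x) y = inner x (K y)" and KK: "\<And>x. K (K (L (L x))) = x"
    and Kcomm: "\<And>Y x. bounded_linear Y \<Longrightarrow> (\<And>x. Y (L (L x)) = L (L (Y x))) \<Longrightarrow> Y (K x) = K (Y x)"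
  proof (rule inverse_sqrt_of_square[OF bL Lsa lower], goal_cases)
    case (2 K)
    show ?case by (rule 2(1)[of K]) (fact 2)+
  qed simp
  have Kadd: "K (x + y) = K x + K y" for x y
  proof -
    have "\<forall>z. inner (K (x + y)) z = inner (K x + K y) z"
      by (simp add: Ksa inner_add_left)
    then show ?thesis using vector_eq_rdot by blast
  qed
  have KL: "K (L x) = L (K x)" for x
    by (rule Kcomm[OF bL, symmetric]) simp
  have KW: "K (W x) = W (K x)" for x
    by (rule Kcomm[OF bW, symmetric]) (simp add: L_def add WW VV)
  have KV: "K (V x) = V (K x)" for x
    by (rule Kcomm[OF bV, symmetric]) (simp add: L_def add WW VV)
  have Kcsc: "K (csc c x) = csc c (K x)" for c x
    by (rule Kcomm[OF bounded_linear_csc, symmetric]) (simp add: scL)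
  define N where "N x = L (K x)" for x
  have NN: "N (N x) = x" for x
    by (simp add: N_def KK flip: KL)
  have Nadd: "N (x + y) = N x + N y" for x y by (simp add: N_def Kadd add)
  have Ncsc: "N (csc c x) = csc c (N x)" for c x by (simp add: N_def Kcsc scL)
  have Nip: "ip (N x) (N y) = ip x y" for x y
  proof (rule isometry_imp_ip[OF Nadd Ncsc])
    have "inner (N x) (N x) = inner x (N (N x))" for x
      by (simp only: N_def Lsa Ksa KL)
    then show "norm (N x) = norm x" for x
      by (simp add: NN norm_eq_sqrt_inner)
  qed
  have NVN: "N (V (N x)) = W x" for x
  proof -
    have "N (V (N x)) = K (K (L (V (L x))))"
      by (simp only: N_def KL KV)
    \<comment> \<open>\<open>V \<circ> L = L \<circ> W\<close>, since both are the identity plus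
      \<open>V \<circ> W\<close>.\<close>
    also have "L (V (L x)) = L (L (W x))"
      by (simp add: L_def add WW VV)
    finally show ?thesis by (simp add: KK)
  qed
  have Ncomm: "Y (N x) = N (Y x)"
    if Y: "bounded_linear Y" and YW: "\<And>x. Y (W x) = W (Y x)" and YV: "\<And>x. Y (V x) = V (Y x)" for Y x
  proof -
    have YL: "Y (L x) = L (Y x)" for x
      using linear_add[OF bounded_linear.linear[OF Y]] by (simp add: L_def YW YV)
    show ?thesis unfolding N_def YL by (rule arg_cong[where f = L], rule Kcomm[OF Y]) (simp only: YL)
  qed
  show ?thesis
    by (rule that[of N, OF Nadd Ncsc Nip NN])
      (simp_all only: NVN[unfolded V_def W_def] Ncomm[unfolded V_def W_def])
qed

text \<open>The sign \<open>N\<close> already turns the adjoint into \<open>comp_mob a\<close>, but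
  it is linear. Composing it with a conjugation \<open>J\<close> that commutes with the operator,
  its adjoint and hence \<open>N\<close> makes it conjugate-linear and keeps it an
  involution.\<close>

lemma comp_mob_symmetric:
  assumes a: "cmod a < 1" and "a \<noteq> 0"
  obtains C where "antiunitary_involution C" "\<And>x. comp_mob a x = C (comp_mob_adj a (C x))"
proof -
  obtain N where N: "\<And>x y. N (x + y) = N x + N y" "\<And>c x. N (csc c x) = csc c (N x)"
    "\<And>x y. ip (N x) (N y) = ip x y" "\<And>x. N (N x) = x"
    "\<And>x. N (comp_mob_adj a (N x)) = comp_mob a x"
    and Ncomm: "\<And>Y x. bounded_linear Y \<Longrightarrow> (\<And>x. Y (comp_mob a x) = comp_mob a (Y x)) \<Longrightarrow>
       (\<And>x. Y (comp_mob_adj a x) = comp_mob_adj a (Y x)) \<Longrightarrow> Y (N x) = N (Y x)"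
  proof (rule comp_mob_sign[OF a], goal_cases)
    case (1 N)
    show ?case by (rule 1(1)[of N]) (fact 1)+
  qed
  \<comment> \<open>With this \<open>m\<close> the map \<open>z \<mapsto> cnj (m * z)\<close> is the
    reflection in the line through 0 and \<open>a\<close>. It fixes \<open>a\<close> and therefore
    commutes with \<open>mob a\<close>.\<close>
  define m where "m = cnj a / a"
  have m: "cmod m = 1" using \<open>a \<noteq> 0\<close> by (simp add: m_def norm_divide)
  define J where "J x = dil m (conj_coeffs x)" for x
  have evJ: "ev (J x) z = cnj (ev x (cnj (m * z)))" for x z
    by (simp add: J_def ev_dil[OF m] ev_conj_coeffs)
  have Jadd: "J (x + y) = J x + J y" for x y
    by (rule ev_inject) (simp add: evJ ev_simps)
  have Jcsc: "J (csc c x) = csc (cnj c) (J x)" for c x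
    by (rule ev_inject) (simp add: evJ ev_simps)
  have Jip: "ip (J x) (J y) = ip y x" for x y
    by (simp add: J_def ip_dil_dil[OF m] ip_conj_coeffs)
  have JJ: "J (J x) = x" for x
  proof (rule ev_inject)
    fix z :: complex
    have "cnj m * m = 1"
      using m complex_norm_square[of m] by (simp add: mult.commute)
    then have "cnj m * (m * z) = z"
      by (simp only: mult.assoc[symmetric] mult_1_left)
    then show "ev (J (J x)) z = ev x z" by (simp only: evJ complex_cnj_mult complex_cnj_cnj)
  qed
  have JipL: "ip (J x) y = ip (J y) x" for x y
    using Jip[of x "J y"] by (simp add: JJ)
  have bJ: "bounded_linear J"
  proof (rule bounded_linear_intro[where K = 1])
    show "J (r *\<^sub>R x) = r *\<^sub>R J x" for r x
      using Jcsc[of "of_real r" x] by (simp add: csc_of_real)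
    have "ip (J x) (J x) = ip x x" for x by (rule Jip)
    then show "norm (J x) \<le> norm x * 1" for x by (simp add: ip_self flip: of_real_power)
  qed (rule Jadd)
  have JW: "J (comp_mob a x) = comp_mob a (J x)" for x
  proof (rule ev_inject)
    fix z :: complex assume z: "cmod z < 1"
    then have mz: "cmod (cnj (m * z)) < 1" using m by (simp add: norm_mult)
    have m_a: "cnj a * cnj m = a" using \<open>a \<noteq> 0\<close> by (simp add: m_def)
    then have "a - cnj m * cnj z = cnj m * (cnj a - cnj z)" by (simp add: right_diff_distrib mult.commute)
    moreover have "1 - cnj a * (cnj m * cnj z) = 1 - a * cnj z"
      by (simp only: mult.assoc[symmetric] m_a)
    ultimately have "mob a (cnj (m * z)) = cnj (m * mob a z)"
      by (simp only: mob_def complex_cnj_mult complex_cnj_divide complex_cnj_diff complex_cnj_cnj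
          complex_cnj_one times_divide_eq_right)
    then show "ev (J (comp_mob a x)) z = ev (comp_mob a (J x)) z"
      using ev_comp_mob[OF a mz] ev_comp_mob[OF a z] by (simp only: evJ)
  qed
  have JV: "J (comp_mob_adj a y) = comp_mob_adj a (J y)" for y
  proof (rule ip_ext)
    fix x
    have "ip (J (comp_mob_adj a y)) x = ip (J x) (comp_mob_adj a y)" by (rule JipL)
    also have "\<dots> = ip (J (comp_mob a x)) y" by (simp only: JW ip_comp_mob[OF a])
    also have "\<dots> = ip (J y) (comp_mob a x)" by (rule JipL)
    finally have "cnj (ip (J (comp_mob_adj a y)) x) = cnj (ip (J y) (comp_mob a x))" by simp
    then show "ip x (J (comp_mob_adj a y)) = ip x (comp_mob_adj a (J y))"
      by (simp add: cnj_ip ip_comp_mob[OF a])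
  qed
  \<comment> \<open>\<open>J\<close> is conjugate-linear, yet \<open>bounded_linear\<close> over the
    reals, so the commutation property of the sign applies to it.\<close>
  have JN: "J (N x) = N (J x)" for x
    by (rule Ncomm[OF bJ JW JV])
  have "antiunitary_involution (\<lambda>x. J (N x))"
    unfolding antiunitary_involution_def
    by (simp add: N(1-3) Jadd Jcsc Jip) (simp add: JN N(4) JJ)
  moreover have "comp_mob a x = J (N (comp_mob_adj a (J (N x))))" for x
    by (simp only: JN[symmetric] JV[symmetric] JJ N(5))
  ultimately show ?thesis using that[of "\<lambda>x. J (N x)"] by blast
qed

subsection \<open>Necessity: automorphisms with an escaping orbit\<close>

lemma ev_ker_0: "cmod z < 1 \<Longrightarrow> ev (ker 0) z = 1"
  by (simp add: ev_ker)

definition monom :: "nat \<Rightarrow> ell2" where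
  "monom m = (shift ^^ m) (ker 0)"

lemma ev_monom: "cmod z < 1 \<Longrightarrow> ev (monom m) z = z ^ m"
  unfolding monom_def by (induction m) (simp_all add: ev_shift ev_ker_0)

lemma ip_monom: "ip x (monom m) = coord x m"
proof (induction m arbitrary: x)
  case 0
  show ?case by (simp add: monom_def ev_0 flip: ev_eq_ip)
next
  case (Suc m)
  have "ip x (monom (Suc m)) = cnj (ip (shift (monom m)) x)"
    by (simp add: monom_def cnj_ip)
  also have "\<dots> = ip (bshift x) (monom m)"
    by (simp add: ip_shift_left cnj_ip)
  finally show ?case by (simp add: Suc)
qed

lemma coord_monom: "coord (monom m) n = (if n = m then 1 else 0)"
  unfolding monom_def
proof (induction m arbitrary: n)
  case 0
  then show ?case by (simp add: coord_ker power_0_left)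
next
  case (Suc m)
  then show ?case by (cases n) auto
qed

text \<open>The multiplier bound applied to the constant function 1, which has norm 1.\<close>

lemma norm_le_of_bounded:
  assumes "\<And>z. cmod z < 1 \<Longrightarrow> cmod (ev x z) \<le> B"
  shows "norm x \<le> B"
proof -
  have "(\<lambda>z. ev x z * ev (ker 0) z) = ev x"
  proof
    show "ev x z * ev (ker 0) z = ev x z" for z
      by (cases "cmod z < 1") (simp_all add: ev_ker_0 ev_outside)
  qed
  then have "norm x \<le> B * norm (ker 0)"
    using mult_in_hardy(2)[OF ev_holomorphic assms, of "ker 0"] by (simp add: coeffs_ev)
  moreover have "ip (ker 0) (ker 0) = 1"
    using ip_monom[of "monom 0" 0] by (simp add: coord_monom) (simp add: monom_def)
  then have "norm (ker 0) = 1"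
    using norm_ge_zero[of "ker 0"] by (simp only: ip_self of_real_eq_1_iff power2_eq_1_iff) linarith
  ultimately show ?thesis by simp
qed

text \<open>A function bounded by 1 whose value at 0 has modulus close to 1 is close in norm to a
  unimodular constant. Apply this to the power \<open>m\<close> of an iterate: \<open>g\<close>
  pairs with it exactly as with the monomial of degree \<open>m\<close>, which ties
  \<open>coord g m\<close> to \<open>coord g 0\<close>.\<close>

lemma adjoint_fixed_vector_zero:
  assumes \<phi>: "\<And>z. cmod z < 1 \<Longrightarrow> cmod (\<phi> z) < 1"
    and T: "\<And>x z. cmod z < 1 \<Longrightarrow> ev (T x) z = ev x (\<phi> z)"
    and g: "\<And>x. ip (T x) g = ip x g"
    and escape: "\<And>r. r < 1 \<Longrightarrow> \<exists>n. r < cmod ((\<phi> ^^ n) 0)"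
  shows "g = 0"
proof -
  have \<phi>n: "cmod ((\<phi> ^^ n) z) < 1" if "cmod z < 1" for n z
    using that by (induction n) (auto intro: \<phi>)
  have Tn: "ev ((T ^^ n) x) z = ev x ((\<phi> ^^ n) z)" if "cmod z < 1" for n x z
    using that by (induction n arbitrary: z) (simp_all add: T \<phi> funpow_swap1[of \<phi>])
  have gn: "ip ((T ^^ n) x) g = ip x g" for n x
    by (induction n) (simp_all add: g)
  have k0: "ip (ker 0) (ker 0) = 1" "ip y (ker 0) = ev y 0" for y
    by (simp_all add: ev_ker_0 flip: ev_eq_ip)
  have close: "\<bar>cmod (coord g m) - cmod (coord g 0)\<bar> \<le> sqrt (2 - 2 * r ^ m) * norm g"
    if r: "r \<in> {0<..<1}" for r m
  proof -
    obtain n where n: "r < cmod ((\<phi> ^^ n) 0)" using escape r by auto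
    define p where "p = (\<phi> ^^ n) 0"
    \<comment> \<open>The phase of \<open>p ^ m\<close>, so that \<open>cnj c * p ^ m\<close> is the
      positive number \<open>cmod p ^ m\<close>.\<close>
    define c where "c = (p / of_real (cmod p)) ^ m"
    define y where "y = (T ^^ n) (monom m)"
    have p: "p \<noteq> 0" "r < cmod p" using n r by (auto simp: p_def)
    have c: "cmod c = 1" using p by (simp add: c_def norm_power norm_divide)
    have "norm y \<le> 1"
    proof (rule norm_le_of_bounded)
      fix z :: complex assume "cmod z < 1"
      then show "cmod (ev y z) \<le> 1"
        using \<phi>n[of z n] by (simp add: y_def Tn ev_monom norm_power power_le_one)
    qed
    have y0: "ev y 0 = p ^ m"
      using \<phi>n[of 0 n] by (simp add: y_def Tn ev_monom p_def)
    have "cnj c * p ^ m = of_real (cmod p ^ m)"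
    proof -
      have "cnj p * p / of_real (cmod p) = of_real (cmod p)"
        using p complex_norm_square[of p] by (simp add: power2_eq_square mult.commute divide_eq_eq)
      then show ?thesis unfolding c_def by (simp flip: power_mult_distrib)
    qed
    moreover have yk: "ip y (ker 0) = p ^ m" using k0(2)[of y] by (simp only: y0)
    then have "ip (ker 0) y = cnj (p ^ m)" using cnj_ip[of y "ker 0"] by simp
    with yk have "ip (y - csc c (ker 0)) (y - csc c (ker 0))
        = of_real ((norm y)\<^sup>2) + c * cnj c - cnj c * p ^ m - cnj (cnj c * p ^ m)"
      by (simp add: ip_simps k0(1) ip_self[of y] right_diff_distrib mult.commute)
    moreover have "c * cnj c = 1" using c by (simp flip: complex_norm_square)
    ultimately have "ip (y - csc c (ker 0)) (y - csc c (ker 0))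
        = of_real ((norm y)\<^sup>2 + 1 - 2 * cmod p ^ m)"
      by simp
    then have "(norm (y - csc c (ker 0)))\<^sup>2 = (norm y)\<^sup>2 + 1 - 2 * cmod p ^ m"
      by (simp only: ip_self of_real_eq_iff)
    also have "\<dots> \<le> 2 - 2 * r ^ m"
    proof -
      have "(norm y)\<^sup>2 \<le> 1" using \<open>norm y \<le> 1\<close> by (simp add: power_le_one)
      moreover have "r ^ m \<le> cmod p ^ m" using p r by (intro power_mono) auto
      ultimately show ?thesis by simp
    qed
    finally have nrm: "norm (y - csc c (ker 0)) \<le> sqrt (2 - 2 * r ^ m)"
      by (rule real_le_rsqrt)
    have 1: "ip y g = cnj (coord g m)"
      unfolding y_def gn ip_monom[symmetric] by (rule cnj_ip[symmetric])
    have 2: "ip (ker 0) g = cnj (coord g 0)"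
      using ip_monom[of g 0] cnj_ip[of g "ker 0"] by (simp add: monom_def)
    have "\<bar>cmod (coord g m) - cmod (coord g 0)\<bar> = \<bar>cmod (ip y g) - cmod (c * ip (ker 0) g)\<bar>"
      by (simp add: 1 2 norm_mult c)
    also have "\<dots> \<le> cmod (ip y g - c * ip (ker 0) g)" by (rule norm_triangle_ineq3)
    also have "\<dots> = cmod (ip (y - csc c (ker 0)) g)" by (simp add: ip_simps)
    also have "\<dots> \<le> norm (y - csc c (ker 0)) * norm g" by (rule ip_Cauchy_Schwarz)
    also have "\<dots> \<le> sqrt (2 - 2 * r ^ m) * norm g" by (intro mult_right_mono nrm) simp
    finally show ?thesis .
  qed
  have eq: "cmod (coord g m) = cmod (coord g 0)" for m
  proof -
    have "((\<lambda>r. sqrt (2 - 2 * r ^ m) * norm g) \<longlongrightarrow> sqrt (2 - 2 * 1 ^ m) * norm g) (at_left (1::real))"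
      by (intro tendsto_intros)
    moreover have "eventually (\<lambda>r. r \<in> {0<..<1::real}) (at_left 1)"
      by (rule eventually_at_left_real) simp
    then have "eventually (\<lambda>r. \<bar>cmod (coord g m) - cmod (coord g 0)\<bar> \<le> sqrt (2 - 2 * r ^ m) * norm g) (at_left 1)"
      by (rule eventually_mono) (rule close)
    ultimately have "\<bar>cmod (coord g m) - cmod (coord g 0)\<bar> \<le> sqrt (2 - 2 * 1 ^ m) * norm g"
      by (rule tendsto_lowerbound) simp
    then show ?thesis by simp
  qed
  define c where "c = cmod (coord g 0)"
  have eq_c: "cmod (coord g m) = c" for m unfolding c_def by (rule eq)
  have "(\<lambda>m. (cmod (coord g m))\<^sup>2) \<longlonglongrightarrow> 0"
    by (rule summable_LIMSEQ_zero[OF summable_coord])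
  then have "c = 0" unfolding eq_c by (simp add: LIMSEQ_const_iff)
  show "g = 0"
  proof (rule ell2_eqI)
    show "coord g m = coord 0 m" for m using eq_c[of m] \<open>c = 0\<close> by simp
  qed
qed

text \<open>For a disk automorphism with matrix \<open>(\<alpha>, \<beta>; cnj \<beta>, cnj \<alpha>)\<close> of determinant 1, the
  \<open>n\<close>-th power of the matrix has off-diagonal entry \<open>u\<^sub>n \<beta>\<close> where \<open>u\<close> is this recursion with
  \<open>t = 2 Re \<alpha>\<close> the trace.\<close>

fun trace_seq :: "real \<Rightarrow> nat \<Rightarrow> real" where
  "trace_seq t 0 = 0"
| "trace_seq t (Suc 0) = 1"
| "trace_seq t (Suc (Suc n)) = t * trace_seq t (Suc n) - trace_seq t n"

text \<open>By Cayley-Hamilton, power \<open>n + 1\<close> of the matrix is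
  \<open>trace_seq t (Suc n)\<close> times the matrix minus \<open>trace_seq t n\<close> times the
  identity. The left-hand side is its determinant.\<close>

lemma trace_seq_invariant:
  "(trace_seq t (Suc n))\<^sup>2 + (trace_seq t n)\<^sup>2 - t * trace_seq t (Suc n) * trace_seq t n = 1"
proof (induction n)
  case (Suc n)
  define p where "p = trace_seq t (Suc n)"
  define q where "q = trace_seq t n"
  have "p\<^sup>2 + q\<^sup>2 - t * p * q = 1" using Suc by (simp add: p_def q_def)
  then have "(t * p - q)\<^sup>2 + p\<^sup>2 - t * (t * p - q) * p = 1"
    by (simp add: power2_eq_square algebra_simps)
  then show ?case by (simp add: p_def q_def)
qed simp

text \<open>Each step at least doubles the modulus and subtracts the previous term, so increments
  never shrink. In the parabolic case \<open>\<bar>t\<bar> = 2\<close> the bound is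
  attained.\<close>

lemma trace_seq_growth:
  assumes "\<bar>t\<bar> \<ge> 2"
  shows "\<bar>trace_seq t n\<bar> + 1 \<le> \<bar>trace_seq t (Suc n)\<bar>"
proof (induction n)
  case (Suc n)
  have "2 * \<bar>trace_seq t (Suc n)\<bar> \<le> \<bar>t * trace_seq t (Suc n)\<bar>"
    using assms by (simp add: abs_mult mult_right_mono)
  then show ?case using Suc by simp
qed simp

lemma trace_seq_ge:
  assumes "\<bar>t\<bar> \<ge> 2"
  shows "real n \<le> \<bar>trace_seq t n\<bar>"
proof (induction n)
  case (Suc n)
  then show ?case using trace_seq_growth[OF assms, of n] by simp
qed simp

text \<open>The iterate \<open>Suc n\<close> has a matrix of determinant 1 with first row
  \<open>A n\<close>, \<open>B n\<close>. It sends 0 to \<open>B n / cnj (A n)\<close>, and the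
  determinant expresses the modulus of \<open>A n\<close> through that of
  \<open>B n\<close>.\<close>

lemma su11_orbit:
  assumes \<phi>: "\<And>z. cmod z < 1 \<Longrightarrow> cmod (\<phi> z) < 1"
    and form: "\<And>z. cmod z < 1 \<Longrightarrow> \<phi> z = (\<alpha> * z + \<beta>) / (cnj \<beta> * z + cnj \<alpha>)"
    and det: "\<alpha> * cnj \<alpha> - \<beta> * cnj \<beta> = 1"
  defines "u \<equiv> trace_seq (2 * Re \<alpha>)"
  shows "(cmod ((\<phi> ^^ Suc n) 0))\<^sup>2 * (1 + (u (Suc n) * cmod \<beta>)\<^sup>2) = (u (Suc n) * cmod \<beta>)\<^sup>2"
proof -
  define A where "A n = of_real (u (Suc n)) * \<alpha> - of_real (u n)" for n
  define B where "B n = of_real (u (Suc n)) * \<beta>" for n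
  have norm_A: "A n * cnj (A n) = 1 + B n * cnj (B n)" for n
  proof -
    define p :: complex where "p = of_real (u (Suc n))"
    define q :: complex where "q = of_real (u n)"
    have tr: "\<alpha> + cnj \<alpha> = of_real (2 * Re \<alpha>)" by (rule complex_add_cnj)
    have "complex_of_real ((u (Suc n))\<^sup>2 + (u n)\<^sup>2 - 2 * Re \<alpha> * u (Suc n) * u n) = of_real 1"
      unfolding u_def by (simp only: trace_seq_invariant)
    then have inv: "p * p + q * q - (\<alpha> + cnj \<alpha>) * p * q = 1"
      unfolding tr p_def q_def by (simp add: power2_eq_square)
    have "(p * \<alpha> - q) * (p * cnj \<alpha> - q) = p * p * (\<alpha> * cnj \<alpha> - \<beta> * cnj \<beta>) + q * q - (\<alpha> + cnj \<alpha>) * p * q + (p * \<beta>) * (p * cnj \<beta>)"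
      by (simp add: algebra_simps)
    also have "\<dots> = 1 + (p * \<beta>) * (p * cnj \<beta>)" unfolding det using inv by simp
    finally show ?thesis by (simp add: A_def B_def p_def q_def)
  qed
  have A_ne: "A n \<noteq> 0" for n
  proof
    assume "A n = 0"
    then have "1 + B n * cnj (B n) = 0" using norm_A[of n] by simp
    then have "1 + (cmod (B n))\<^sup>2 = 0"
      unfolding complex_norm_square[symmetric] by (metis of_real_1 of_real_add of_real_eq_0_iff)
    then show False using zero_le_power2[of "cmod (B n)"] by linarith
  qed
  have \<phi>n: "cmod ((\<phi> ^^ n) 0) < 1" for n
    by (induction n) (auto intro: \<phi>)
  have orbit: "(\<phi> ^^ Suc n) 0 = B n / cnj (A n)" for n
  proof (induction n)
    case 0
    show ?case by (simp add: form A_def B_def u_def)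
  next
    case (Suc n)
    define p :: complex where "p = of_real (u (Suc n))"
    define q :: complex where "q = of_real (u n)"
    define d where "d = cnj (A n)"
    have d: "d \<noteq> 0" "d = p * cnj \<alpha> - q"
      using A_ne[of n] by (simp add: d_def) (simp add: d_def A_def p_def q_def)
    have Bn: "B n = p * \<beta>" by (simp add: B_def p_def)
    have tr: "of_real (u (Suc (Suc n))) = (\<alpha> + cnj \<alpha>) * p - q"
      by (simp add: u_def p_def q_def complex_add_cnj)
    have num: "\<alpha> * B n + \<beta> * d = B (Suc n)"
      unfolding B_def[of "Suc n"] tr unfolding Bn d(2) by (simp add: algebra_simps)
    have "cnj \<beta> * B n + cnj \<alpha> * d = p * (\<beta> * cnj \<beta>) + cnj \<alpha> * (p * cnj \<alpha> - q)"
      unfolding Bn d(2) by (simp add: algebra_simps)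
    also have "\<beta> * cnj \<beta> = \<alpha> * cnj \<alpha> - 1" using det by (simp add: algebra_simps)
    also have "p * (\<alpha> * cnj \<alpha> - 1) + cnj \<alpha> * (p * cnj \<alpha> - q)
        = ((\<alpha> + cnj \<alpha>) * p - q) * cnj \<alpha> - p"
      by (simp add: algebra_simps)
    also have "\<dots> = cnj (A (Suc n))"
      unfolding A_def tr[symmetric] by (simp add: p_def)
    finally have den: "cnj \<beta> * B n + cnj \<alpha> * d = cnj (A (Suc n))" .
    have "(\<phi> ^^ Suc (Suc n)) 0 = \<phi> (B n / d)" using Suc by (simp add: d_def)
    also have "\<dots> = (\<alpha> * (B n / d) + \<beta>) / (cnj \<beta> * (B n / d) + cnj \<alpha>)"
      using \<phi>n[of "Suc n"] unfolding Suc d_def[symmetric] by (rule form)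
    also have "\<dots> = ((\<alpha> * B n + \<beta> * d) / d) / ((cnj \<beta> * B n + cnj \<alpha> * d) / d)"
      using d(1) by (simp add: add_divide_distrib)
    also have "\<dots> = B (Suc n) / cnj (A (Suc n))"
      unfolding num den using d(1) by simp
    finally show ?case .
  qed
  have "complex_of_real ((cmod (A n))\<^sup>2) = of_real (1 + (cmod (B n))\<^sup>2)"
    using norm_A[of n] unfolding complex_norm_square[symmetric] by simp
  then have A2: "(cmod (A n))\<^sup>2 = 1 + (cmod (B n))\<^sup>2" by (simp only: of_real_eq_iff)
  have B2: "(u (Suc n) * cmod \<beta>)\<^sup>2 = (cmod (B n))\<^sup>2"
    by (simp add: B_def norm_mult power_mult_distrib)
  have "(cmod ((\<phi> ^^ Suc n) 0))\<^sup>2 = (cmod (B n))\<^sup>2 / (cmod (A n))\<^sup>2"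
    unfolding orbit by (simp add: norm_divide power_divide)
  then show ?thesis unfolding B2 A2[symmetric] using A_ne[of n] by simp
qed

text \<open>Substituting \<open>cnj \<beta> * z = \<i> * y\<close> turns the fixed point equation
  into a real quadratic in \<open>y\<close>, whose discriminant is positive exactly when the trace
  has modulus below 2.\<close>

lemma su11_fixpoint:
  assumes det: "\<alpha> * cnj \<alpha> - \<beta> * cnj \<beta> = 1" and "\<bar>Re \<alpha>\<bar> < 1" "\<beta> \<noteq> 0"
  obtains z where "cmod z < 1" "(\<alpha> * z + \<beta>) / (cnj \<beta> * z + cnj \<alpha>) = z"
proof -
  define q where "q = sqrt (1 - (Re \<alpha>)\<^sup>2)"
  have "(Re \<alpha>)\<^sup>2 < 1" using assms(2) by (simp add: abs_square_less_1)
  then have q: "q > 0" "q\<^sup>2 = 1 - (Re \<alpha>)\<^sup>2" by (simp_all add: q_def)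
  have "complex_of_real ((cmod \<alpha>)\<^sup>2 - (cmod \<beta>)\<^sup>2) = of_real 1"
    using det by (simp only: of_real_diff complex_norm_square of_real_1)
  then have norms: "(cmod \<alpha>)\<^sup>2 - (cmod \<beta>)\<^sup>2 = 1" by (simp only: of_real_eq_iff)
  then have b2: "(cmod \<beta>)\<^sup>2 = (Im \<alpha>)\<^sup>2 - q\<^sup>2" unfolding q(2) by (simp add: cmod_power2)
  have b_pos: "(cmod \<beta>)\<^sup>2 > 0" using assms(3) by simp
  \<comment> \<open>The root of smaller modulus: the two roots have product
    \<open>(cmod \<beta>)\<^sup>2\<close>, so this one puts \<open>z\<close> inside the
    disk.\<close>
  define y where "y = (if Im \<alpha> > 0 then Im \<alpha> - q else Im \<alpha> + q)"
  have y_eq: "y\<^sup>2 - 2 * Im \<alpha> * y + (cmod \<beta>)\<^sup>2 = 0"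
    unfolding b2 y_def by (auto simp: power2_eq_square algebra_simps)
  have y_lt: "y\<^sup>2 < (cmod \<beta>)\<^sup>2"
  proof -
    have *: "\<bar>Im \<alpha>\<bar> > q" using b_pos b2 q(1)
      by (metis abs_ge_zero diff_gt_0_iff_gt power2_abs power2_less_imp_less)
    have "y\<^sup>2 = (\<bar>Im \<alpha>\<bar> - q) * (\<bar>Im \<alpha>\<bar> - q)"
      by (auto simp: y_def power2_eq_square abs_if algebra_simps)
    also have "\<dots> < (\<bar>Im \<alpha>\<bar> - q) * (\<bar>Im \<alpha>\<bar> + q)"
      using * q(1) by (intro mult_strict_left_mono) auto
    also have "\<dots> = (cmod \<beta>)\<^sup>2"
      unfolding b2 by (simp add: power2_eq_square algebra_simps)
    finally show ?thesis .
  qed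
  define z where "z = \<i> * of_real y / cnj \<beta>"
  have \<beta>z: "cnj \<beta> * z = \<i> * of_real y" using assms(3) by (simp add: z_def)
  have "\<bar>y\<bar> < cmod \<beta>" using y_lt by (metis norm_ge_zero power2_abs power2_less_imp_less)
  then have z_lt: "cmod z < 1" using assms(3) by (simp add: z_def norm_divide norm_mult divide_less_eq)
  have "\<alpha> - cnj \<alpha> = 2 * Im \<alpha> * \<i>" by (simp add: complex_eq_iff)
  then have "cnj \<beta> * (z * (\<alpha> - cnj \<alpha> - cnj \<beta> * z) + \<beta>)
      = \<i> * of_real y * (2 * of_real (Im \<alpha>) * \<i> - \<i> * of_real y) + of_real ((cmod \<beta>)\<^sup>2)"
    unfolding \<beta>z complex_norm_square distrib_left mult.assoc[of "cnj \<beta>" z, symmetric] by (simp add: mult.commute)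
  also have "\<dots> = of_real (y\<^sup>2 - 2 * Im \<alpha> * y + (cmod \<beta>)\<^sup>2)"
    by (simp add: complex_eq_iff power2_eq_square algebra_simps)
  finally have "z * (\<alpha> - cnj \<alpha> - cnj \<beta> * z) + \<beta> = 0"
    using assms(3) unfolding y_eq by simp
  then have eq: "\<alpha> * z + \<beta> = z * (cnj \<beta> * z + cnj \<alpha>)"
    by (simp add: algebra_simps)
  have "cnj \<beta> * z + cnj \<alpha> \<noteq> 0"
  proof
    assume "cnj \<beta> * z + cnj \<alpha> = 0"
    then have "cmod (cnj \<beta> * z) = cmod \<alpha>"
      by (metis add_eq_0_iff complex_mod_cnj norm_minus_cancel)
    then have "\<bar>y\<bar> = cmod \<alpha>" unfolding \<beta>z by (simp add: norm_mult)
    then have "(cmod \<alpha>)\<^sup>2 = y\<^sup>2" by (metis power2_abs)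
    then show False using y_lt norms by simp
  qed
  with eq have "(\<alpha> * z + \<beta>) / (cnj \<beta> * z + cnj \<alpha>) = z" by simp
  with z_lt show ?thesis by (rule that)
qed

text \<open>Trace of modulus below 2 gives a fixed point. Otherwise the off-diagonal entries grow at
  least linearly and drive the orbit of 0 to the circle, against the bound \<open>r\<close>.\<close>

lemma disk_automorphism_fixpoint_or_escape:
  assumes u: "cmod u = 1" and b: "cmod b < 1" "b \<noteq> 0"
    and form: "\<And>z. cmod z < 1 \<Longrightarrow> \<phi> z = u * mob b z"
    and no_escape: "r < 1" "\<And>n. cmod ((\<phi> ^^ n) 0) \<le> r"
  obtains a where "cmod a < 1" "\<phi> a = a"
proof -
  \<comment> \<open>The sign comes from the numerator \<open>b - z\<close> of \<open>mob b\<close>: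
    \<open>u * (b - z) = v * v * (z - b)\<close>. Placing \<open>v\<close> above and
    \<open>cnj v\<close> below, both scaled by \<open>s\<close>, gives a matrix of determinant
    1.\<close>
  define v where "v = csqrt (- u)"
  have v2: "v * v = - u" unfolding v_def by (simp flip: power2_eq_square)
  have v: "cmod v = 1" by (simp add: v_def u)
  have vc: "v * cnj v = 1" using v by (simp flip: complex_norm_square)
  define s :: complex where "s = of_real (1 / sqrt (1 - (cmod b)\<^sup>2))"
  have D: "1 - (cmod b)\<^sup>2 > 0" by (rule one_minus_norm_sq_pos[OF b(1)])
  have s0: "s \<noteq> 0" using D by (simp add: s_def)
  have "1 / sqrt (1 - (cmod b)\<^sup>2) * (1 / sqrt (1 - (cmod b)\<^sup>2)) * (1 - (cmod b)\<^sup>2) = 1"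
    using D by simp
  then have "s * s * of_real (1 - (cmod b)\<^sup>2) = of_real 1"
    unfolding s_def of_real_mult[symmetric] by (simp only: )
  then have ss: "s * s * (1 - b * cnj b) = 1"
    by (simp only: of_real_diff of_real_1 complex_norm_square)
  define \<alpha> where "\<alpha> = s * v"
  define \<beta> where "\<beta> = - s * v * b"
  have cs: "cnj s = s" by (simp add: s_def)
  have det: "\<alpha> * cnj \<alpha> - \<beta> * cnj \<beta> = 1"
  proof -
    have "\<alpha> * cnj \<alpha> - \<beta> * cnj \<beta> = (s * s * (1 - b * cnj b)) * (v * cnj v)"
      unfolding \<alpha>_def \<beta>_def by (simp add: cs algebra_simps)
    then show ?thesis by (simp only: ss vc mult_1)
  qed
  have \<phi>: "\<phi> z = (\<alpha> * z + \<beta>) / (cnj \<beta> * z + cnj \<alpha>)" if z: "cmod z < 1" for z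
  proof -
    have "cnj \<beta> * z + cnj \<alpha> = s * cnj v * (1 - cnj b * z)"
      unfolding \<alpha>_def \<beta>_def by (simp add: cs algebra_simps)
    moreover have "\<alpha> * z + \<beta> = (s * cnj v) * (v * v * (z - b))"
    proof -
      have "(s * cnj v) * (v * v * (z - b)) = s * (v * cnj v) * v * (z - b)" by (simp add: mult_ac)
      also have "\<dots> = \<alpha> * z + \<beta>" unfolding vc \<alpha>_def \<beta>_def by (simp add: algebra_simps)
      finally show ?thesis by simp
    qed
    moreover have "s * cnj v \<noteq> 0" using s0 v by auto
    ultimately have "(\<alpha> * z + \<beta>) / (cnj \<beta> * z + cnj \<alpha>) = (v * v * (z - b)) / (1 - cnj b * z)"
      by (metis mult_divide_mult_cancel_left)
    also have "\<dots> = \<phi> z" unfolding v2 form[OF z] mob_def by (simp add: algebra_simps)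
    finally show ?thesis by simp
  qed
  have \<phi>_disk: "cmod (\<phi> z) < 1" if "cmod z < 1" for z
    unfolding form[OF that] using norm_mob[OF b(1) that] by (simp add: norm_mult u)
  have \<beta>0: "\<beta> \<noteq> 0" using s0 v b by (auto simp: \<beta>_def)
  show ?thesis
  proof (cases "\<bar>Re \<alpha>\<bar> < 1")
    case True
    obtain z where "cmod z < 1" "(\<alpha> * z + \<beta>) / (cnj \<beta> * z + cnj \<alpha>) = z"
      by (rule su11_fixpoint[OF det True \<beta>0])
    then show ?thesis using \<phi> that by metis
  next
    case False
    then have t: "\<bar>2 * Re \<alpha>\<bar> \<ge> 2" by simp
    have r: "0 \<le> r" using no_escape(2)[of 0] by simp
    have r1: "1 - r\<^sup>2 > 0" using no_escape(1) r by (simp add: abs_square_less_1)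
    have bound: "(real (Suc n) * cmod \<beta>)\<^sup>2 \<le> 1 / (1 - r\<^sup>2)" for n
    proof -
      define B where "B = trace_seq (2 * Re \<alpha>) (Suc n) * cmod \<beta>"
      have "(real (Suc n) * cmod \<beta>)\<^sup>2 \<le> (\<bar>trace_seq (2 * Re \<alpha>) (Suc n)\<bar> * cmod \<beta>)\<^sup>2"
        by (intro power_mono mult_right_mono trace_seq_ge[OF t]) auto
      also have "\<dots> = B\<^sup>2" by (simp add: B_def power_mult_distrib)
      also have "B\<^sup>2 \<le> 1 / (1 - r\<^sup>2)"
      proof -
        have "B\<^sup>2 = (cmod ((\<phi> ^^ Suc n) 0))\<^sup>2 * (1 + B\<^sup>2)"
          unfolding B_def by (rule su11_orbit[OF \<phi>_disk \<phi> det, symmetric])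
        also have "\<dots> \<le> r\<^sup>2 * (1 + B\<^sup>2)"
          by (intro mult_right_mono power_mono no_escape(2)) auto
        finally have "B\<^sup>2 * (1 - r\<^sup>2) \<le> r\<^sup>2" by (simp add: algebra_simps)
        then have "B\<^sup>2 * (1 - r\<^sup>2) \<le> 1" using r1 by simp
        then show ?thesis using r1 by (simp add: pos_le_divide_eq)
      qed
      finally show ?thesis .
    qed
    \<comment> \<open>The extra \<open>1 / cmod \<beta>\<close> pushes
      \<open>real (Suc n) * cmod \<beta>\<close> above 1, where a number is at most its
      square.\<close>
    obtain n where n: "real n > 1 / (1 - r\<^sup>2) / cmod \<beta> + 1 / cmod \<beta>"
      using reals_Archimedean2 by blast
    have "cmod \<beta> > 0" using \<beta>0 by simp
    moreover have "(1 / (1 - r\<^sup>2) + 1) / cmod \<beta> < real n" using n by (simp only: add_divide_distrib)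
    ultimately have "1 / (1 - r\<^sup>2) + 1 < real n * cmod \<beta>" by (simp only: pos_divide_less_eq)
    moreover have "real n * cmod \<beta> \<le> real (Suc n) * cmod \<beta>" by (intro mult_right_mono) auto
    ultimately have big: "real (Suc n) * cmod \<beta> > 1 / (1 - r\<^sup>2) + 1" by linarith
    have pos: "1 / (1 - r\<^sup>2) > 0" using r1 by simp
    have "real (Suc n) * cmod \<beta> \<le> (real (Suc n) * cmod \<beta>)\<^sup>2"
      by (rule self_le_power) (use big pos in linarith, simp)
    then show ?thesis using bound[of n] big by linarith
  qed
qed

subsection \<open>Necessity: elliptic automorphisms\<close>

text \<open>The eigenspace of \<open>dil l\<close> to \<open>l ^ j\<close>, given by supports. For a
  root of unity \<open>l\<close> many exponents share one eigenvalue and the space is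
  infinite-dimensional.\<close>

definition dil_eigen :: "complex \<Rightarrow> nat \<Rightarrow> ell2 \<Rightarrow> bool" where
  "dil_eigen l j h \<longleftrightarrow> (\<forall>n. coord h n \<noteq> 0 \<longrightarrow> l ^ n = l ^ j)"

text \<open>The right-hand side is the eigenvector relation for the adjoint of \<open>dil l\<close>,
  in weak form; testing it on monomials recovers the support.\<close>

lemma dil_eigen_iff:
  assumes l: "cmod l = 1"
  shows "dil_eigen l j h \<longleftrightarrow> (\<forall>y. ip (dil l y) h = l ^ j * ip y h)"
proof
  assume h: "dil_eigen l j h"
  have *: "coord (dil l y) n * cnj (coord h n) = l ^ j * (coord y n * cnj (coord h n))" for y n
    using h by (cases "coord h n = 0") (auto simp: dil_eigen_def coord_dil l)
  show "\<forall>y. ip (dil l y) h = l ^ j * ip y h"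
    unfolding ip_def * by (intro allI suminf_mult summable_ip)
next
  assume h: "\<forall>y. ip (dil l y) h = l ^ j * ip y h"
  show "dil_eigen l j h"
    unfolding dil_eigen_def
  proof (intro allI impI)
    fix n assume "coord h n \<noteq> 0"
    have "dil l (monom n) = csc (l ^ n) (monom n)"
      by (rule ell2_eqI) (simp add: coord_dil l coord_monom)
    then have "l ^ n * ip (monom n) h = l ^ j * ip (monom n) h"
      using h by (metis ip_csc_left)
    moreover have "ip (monom n) h \<noteq> 0"
      using \<open>coord h n \<noteq> 0\<close> cnj_ip[of h "monom n"] by (auto simp: ip_monom)
    ultimately show "l ^ n = l ^ j" by simp
  qed
qed

lemma dil_eigen_orthogonal:
  assumes "dil_eigen l i h" "dil_eigen l j k" "l ^ i \<noteq> l ^ j"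
  shows "ip h k = 0"
proof -
  have *: "coord h n * cnj (coord k n) = 0" for n
    using assms by (auto simp: dil_eigen_def)
  show ?thesis unfolding ip_def * by (rule suminf_zero)
qed

lemma dil_eigen_bshift:
  assumes "dil_eigen l (Suc j) h" "l \<noteq> 0"
  shows "dil_eigen l j (bshift h)"
  unfolding dil_eigen_def
proof (intro allI impI)
  fix n assume "coord (bshift h) n \<noteq> 0"
  then have "l ^ Suc n = l ^ Suc j" using assms(1) unfolding dil_eigen_def by (metis bshift.rep_eq)
  then show "l ^ n = l ^ j" using assms(2) by simp
qed

lemma ip_bshift_bshift:
  assumes "coord h 0 = 0"
  shows "ip (bshift h) (bshift h) = ip h h"
proof -
  have "shift (bshift h) = h"
  proof (rule ell2_eqI)
    show "coord (shift (bshift h)) n = coord h n" for n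
      using assms by (cases n) auto
  qed
  then show ?thesis using ip_shift_shift[of "bshift h" "bshift h"] by simp
qed

text \<open>Write \<open>V\<^sub>j\<close> for the eigenspace of \<open>T\<^sup>*\<close> to \<open>cnj l\<^sup>j\<close>; a conjugation exchanges it with the
  eigenspace \<open>E\<^sub>j\<close> of \<open>T\<close> to \<open>l\<^sup>j\<close>. Multiplication by \<open>mob a\<close> embeds the pair \<open>(E\<^sub>0, E\<^sub>1)\<close>
  isometrically into \<open>(E\<^sub>1, E\<^sub>2)\<close>, so the cosine of the angle between \<open>V\<^sub>1\<close> and \<open>V\<^sub>2\<close> would be at
  least that between \<open>V\<^sub>0\<close> and \<open>V\<^sub>1\<close>. But the former is at most \<open>\<bar>a\<bar> / (1 + \<bar>a\<bar>\<^sup>2)\<close>, while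
  the images of 1 and \<open>z\<close> under the adjoint of \<open>comp_mob a\<close> give at least
  \<open>\<bar>a\<bar> / sqrt (1 + \<bar>a\<bar>\<^sup>2)\<close> for the latter.\<close>

lemma elliptic_not_symmetric:
  assumes a: "cmod a < 1" "a \<noteq> 0" and l: "cmod l = 1" "l\<^sup>2 \<noteq> 1"
    and T: "\<And>x z. cmod z < 1 \<Longrightarrow> ev (T x) z = ev x (mob a (l * mob a z))"
    and C: "antiunitary_involution C" and S: "\<And>x y. ip (T x) y = ip x (S y)"
    and CS: "\<And>x. T x = C (S (C x))"
  shows False
proof -
  note CD = antiunitary_involutionD[OF C]
  define W where "W = comp_mob a"
  define V where "V = comp_mob_adj a"
  define d :: complex where "d = of_real (1 - (cmod a)\<^sup>2)"
  define E where "E h = h - csc a (bshift h)" for h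
  have d0: "d \<noteq> 0" using one_minus_norm_sq_pos[OF a(1)] unfolding d_def of_real_eq_0_iff by simp
  have l0: "l \<noteq> 0" using l(1) by auto
  have l1: "l \<noteq> 1" using l(2) by auto
  have WV: "ip (W x) y = ip x (V y)" for x y unfolding W_def V_def by (rule ip_comp_mob[OF a(1)])
  have VV: "V (V x) = x" for x unfolding V_def by (rule comp_mob_adj_comp_mob_adj[OF a(1)])
  have WW: "W (W x) = x" for x unfolding W_def by (rule comp_mob_comp_mob[OF a(1)])
  have lmob: "cmod (l * mob a z) < 1" if "cmod z < 1" for z
    using norm_mob[OF a(1) that] l(1) by (simp add: norm_mult)
  have T_eq: "T x = W (dil l (W x))" for x
    unfolding W_def
    by (rule ev_inject) (simp add: T ev_comp_mob a(1) norm_mob ev_dil l(1) lmob)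
  have ipV: "ip (V h) (V k) = ip (E h) (E k) / d" for h k
    unfolding V_def E_def d_def by (rule ip_comp_mob_adj[OF a(1)])

  define eig where "eig j p \<longleftrightarrow> T p = csc (l ^ j) p" for j p
  define coeig where "coeig j f \<longleftrightarrow> (\<forall>x. ip (T x) f = l ^ j * ip x f)" for j f
  have eig_C: "coeig j (C p)" if "eig j p" for j p
  proof -
    have "S (C p) = C (T p)" by (simp add: CS CD(4))
    also have "\<dots> = csc (cnj (l ^ j)) (C p)" using that by (simp only: eig_def CD(2))
    finally show ?thesis by (simp add: coeig_def S ip_csc_right)
  qed
  have coeig_C: "eig j (C f)" if "coeig j f" for j f
  proof -
    have "S f = csc (cnj (l ^ j)) f"
      by (rule ip_ext) (use that in \<open>simp add: coeig_def ip_csc_right flip: S\<close>)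
    then show ?thesis by (simp add: eig_def CS CD(4) CD(2))
  qed
  have coeig_V: "coeig j (V h)" if "dil_eigen l j h" for j h
    using that unfolding dil_eigen_iff[OF l(1)] coeig_def by (simp add: T_eq WV VV flip: WV[of _ "V _"])
  have V_coeig: "dil_eigen l j (V f)" if "coeig j f" for j f
    unfolding dil_eigen_iff[OF l(1)]
  proof
    fix y
    have "ip (T (W y)) f = l ^ j * ip (W y) f" using that by (simp only: coeig_def)
    then show "ip (dil l y) (V f) = l ^ j * ip y (V f)" by (simp only: T_eq WW WV)
  qed
  \<comment> \<open>\<open>mob a\<close> is itself an eigenfunction: composing it with the
    automorphism multiplies it by \<open>l\<close>.\<close>
  have eig_mult: "eig (Suc j) (mob_mult a p)" if "eig j p" for j p
    unfolding eig_def
  proof (rule ev_inject)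
    fix z :: complex assume z: "cmod z < 1"
    have "ev (T (mob_mult a p)) z = l * mob a z * ev (T p) z"
      by (simp add: T z ev_mob_mult a(1) mob_mob lmob)
    also have "ev (T p) z = l ^ j * ev p z" using that by (simp only: eig_def ev_csc)
    finally show "ev (T (mob_mult a p)) z = ev (csc (l ^ Suc j) (mob_mult a p)) z"
      by (simp add: ev_csc ev_mob_mult a(1))
  qed

  have E_ip: "ip (E h) (E k) = ip h k - cnj a * ip h (bshift k) - a * ip (bshift h) k
      + a * cnj a * ip (bshift h) (bshift k)" for h k
    by (simp add: E_def ip_simps algebra_simps)
  have E_norm: "ip (E h) (E h) = (1 + a * cnj a) * ip h h"
    if h: "dil_eigen l (Suc j) h" and "l ^ Suc j \<noteq> 1" for j h
  proof -
    have ne: "l ^ j \<noteq> l ^ Suc j" using l1 l0 by simp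
    have b: "dil_eigen l j (bshift h)" by (rule dil_eigen_bshift[OF h l0])
    \<comment> \<open>The exponent 0 belongs to the eigenvalue 1, which differs from
      \<open>l ^ Suc j\<close>. Without a constant term the backward shift loses no norm.\<close>
    have "coord h 0 = 0" using h that(2) unfolding dil_eigen_def by (metis power_0)
    then have "ip (bshift h) (bshift h) = ip h h" by (rule ip_bshift_bshift)
    moreover have "ip (bshift h) h = 0" "ip h (bshift h) = 0"
      using dil_eigen_orthogonal[OF b h ne] dil_eigen_orthogonal[OF h b ne[symmetric]] by auto
    ultimately show ?thesis unfolding E_ip by (simp add: algebra_simps)
  qed

  define v0 where "v0 = V (monom 0)"
  define v1 where "v1 = V (monom 1)"
  have E0: "E (monom 0) = monom 0"
    by (rule ell2_eqI) (simp add: E_def coord_monom)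
  have E1: "E (monom 1) = monom 1 - csc a (monom 0)"
    by (rule ell2_eqI) (simp add: E_def coord_monom)
  have v: "ip v0 v0 = 1 / d" "ip v1 v1 = (1 + a * cnj a) / d" "ip v0 v1 = - cnj a / d"
    unfolding v0_def v1_def ipV E0 E1 by (simp_all add: ip_simps ip_monom coord_monom)
  have mon: "dil_eigen l j (monom j)" for j
    by (auto simp: dil_eigen_def coord_monom split: if_splits)
  have co0: "coeig 0 v0" unfolding v0_def by (rule coeig_V[OF mon])
  have co1: "coeig 1 v1" unfolding v1_def by (rule coeig_V[OF mon])

  \<comment> \<open>The two conjugations reverse inner products twice, so \<open>f\<close> and
    \<open>g\<close> keep the Gram matrix of \<open>v0\<close> and \<open>v1\<close> while the
    indices 0 and 1 rise to 1 and 2.\<close>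
  define f where "f = C (mob_mult a (C v0))"
  define g where "g = C (mob_mult a (C v1))"
  have "coeig (Suc 0) f" unfolding f_def by (intro eig_C eig_mult coeig_C co0)
  moreover have "coeig (Suc 1) g" unfolding g_def by (intro eig_C eig_mult coeig_C co1)
  moreover define h where "h = V f"
  moreover define k where "k = V g"
  ultimately have h: "dil_eigen l (Suc 0) h" and k: "dil_eigen l (Suc 1) k"
    using V_coeig by blast+
  have fh: "f = V h" and gk: "g = V k" by (simp_all add: h_def k_def VV)
  have fg: "ip f f = ip v0 v0" "ip g g = ip v1 v1" "ip f g = ip v0 v1"
    unfolding f_def g_def by (simp_all add: CD(3) ip_mob_mult[OF a(1)])

  have a1: "1 + a * cnj a \<noteq> 0"
  proof -
    have "1 + a * cnj a = of_real (1 + (cmod a)\<^sup>2)" by (simp only: of_real_add of_real_1 complex_norm_square)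
    moreover have "1 + (cmod a)\<^sup>2 > 0" by (simp add: add_pos_nonneg)
    ultimately show ?thesis by (metis less_irrefl of_real_eq_0_iff)
  qed
  have "(1 + a * cnj a) * ip h h = 1"
    using fg(1) d0 unfolding fh ipV v E_norm[OF h, simplified, OF l1] by simp
  moreover have "ip k k = 1"
    using fg(2) d0 a1 l(2) unfolding gk ipV v E_norm[OF k, simplified] by (simp add: E_norm[OF k] power2_eq_square)
  moreover have "ip h (bshift k) = 1"
  proof -
    \<comment> \<open>Exactly the distinctness of the three eigenvalues; higher powers of
      \<open>l\<close> may coincide with them. Of the four terms of \<open>ip (E h) (E k)\<close>
      only the one pairing \<open>h\<close> with \<open>bshift k\<close> survives.\<close>
    have ne: "l ^ 1 \<noteq> l ^ 2" "l ^ 0 \<noteq> l ^ 2" "l ^ 0 \<noteq> l ^ 1" using l1 l0 l(2) by (auto simp: power2_eq_square)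
    have bh: "dil_eigen l 0 (bshift h)" by (rule dil_eigen_bshift[OF h l0])
    have bk: "dil_eigen l 1 (bshift k)" by (rule dil_eigen_bshift[OF k l0])
    have h1: "dil_eigen l 1 h" and k2: "dil_eigen l 2 k" using h k by (simp_all add: numeral_2_eq_2)
    have "ip (E h) (E k) = - cnj a * ip h (bshift k)"
      unfolding E_ip
      by (simp add: dil_eigen_orthogonal[OF h1 k2 ne(1)] dil_eigen_orthogonal[OF bh k2 ne(2)]
          dil_eigen_orthogonal[OF bh bk ne(3)])
    then show ?thesis using fg(3) d0 a(2) unfolding fh gk ipV v by simp
  qed
  ultimately have hk: "(1 + (cmod a)\<^sup>2) * (norm h)\<^sup>2 = 1" "(norm k)\<^sup>2 = 1" "ip h (bshift k) = 1"
    by (simp_all only: ip_self flip: complex_norm_square)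
      (metis of_real_1 of_real_add of_real_eq_iff of_real_mult, metis of_real_1 of_real_eq_iff)
  have "(norm (bshift k))\<^sup>2 \<le> 1"
  proof -
    have "norm (bshift k) * norm (bshift k) = Re (ip (shift (bshift k)) k)"
      by (simp add: ip_shift_left ip_self power2_eq_square)
    also have "\<dots> \<le> norm (shift (bshift k)) * norm k"
      using ip_Cauchy_Schwarz complex_Re_le_cmod order_trans by blast
    finally have "norm (bshift k) * norm (bshift k) \<le> norm (bshift k) * norm k" by simp
    then have "norm (bshift k) \<le> norm k" by (metis mult_le_cancel_left_pos norm_ge_zero order_le_less)
    then show ?thesis using hk(2) by (metis norm_ge_zero power_mono)
  qed
  moreover have "1 \<le> (norm h)\<^sup>2 * (norm (bshift k))\<^sup>2"
  proof -
    have "1 \<le> norm h * norm (bshift k)" using ip_Cauchy_Schwarz[of h "bshift k"] hk(3) by simp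
    then have "1\<^sup>2 \<le> (norm h * norm (bshift k))\<^sup>2" by (intro power_mono) auto
    then show ?thesis by (simp add: power_mult_distrib)
  qed
  ultimately have "1 \<le> (norm h)\<^sup>2"
    using mult_left_mono[of "(norm (bshift k))\<^sup>2" 1 "(norm h)\<^sup>2"] by simp
  moreover have "(cmod a)\<^sup>2 > 0" using a(2) by simp
  ultimately have "1 * 1 < (1 + (cmod a)\<^sup>2) * (norm h)\<^sup>2"
    by (intro mult_less_le_imp_less) auto
  then show False using hk(1) by simp
qed

subsection \<open>The classification\<close>

theorem mainTheorem1:
  fixes \<phi> :: "complex \<Rightarrow> complex"
  assumes "disk_automorphism \<phi>"
  shows "complex_symmetric hardy_space fun_scale hardy_inner (composition_operator \<phi>)
           \<longleftrightarrow> is_rotation \<phi> \<or> involutive_automorphism \<phi>"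
proof -
  obtain u b where u: "cmod u = 1" and b: "cmod b < 1"
    and form: "\<And>z. cmod z < 1 \<Longrightarrow> \<phi> z = u * mob b z"
  proof (rule disk_automorphism_form[OF assms], goal_cases)
    case (1 u b)
    show ?case by (rule 1(1)[of u b]) (fact 1)+
  qed
  define T where "T x = comp_mob b (dil u x)" for x
  have T: "ev (T x) z = ev x (\<phi> z)" if "cmod z < 1" for x z
    by (simp add: T_def ev_comp_mob b that ev_dil u form)
  obtain K where K: "\<And>x. norm (comp_mob b x) \<le> norm x * K"
    using bounded_linear.bounded[OF bounded_linear_comp_mob[OF b]] by blast
  have "norm (dil u x) = norm x" for x
    using ip_dil_dil[OF u, of x x] by (simp add: ip_self flip: of_real_power)
  then have bd: "norm (T x) \<le> K * norm x" for x
    using K[of "dil u x"] by (simp add: T_def mult.commute)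
  have \<phi>_disk: "cmod (\<phi> z) < 1" if "cmod z < 1" for z
    by (rule disk_automorphismD(3)[OF assms that])
  let ?sym = "\<exists>C S. antiunitary_involution C \<and> (\<forall>x y. ip (T x) y = ip x (S y)) \<and> (\<forall>x. T x = C (S (C x)))"
  have rotation_sym: ?sym if rot: "is_rotation \<phi>"
  proof -
    obtain s where s: "cmod s = 1" "\<forall>z\<in>unit_disk. \<phi> z = s * z"
      using rot unfolding is_rotation_def by blast
    have T_dil: "T x = dil s x" for x
      by (rule ev_inject) (simp add: T ev_dil s)
    have "antiunitary_involution conj_coeffs"
      unfolding antiunitary_involution_def
      by (auto intro: ell2_eqI simp: ip_conj_coeffs)
    moreover have "ip (T x) y = ip x (dil (cnj s) y)" for x y
      unfolding T_dil by (rule ip_dil_left[OF s(1)])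
    moreover have "T x = conj_coeffs (dil (cnj s) (conj_coeffs x))" for x
      unfolding T_dil by (rule ell2_eqI) (simp add: coord_dil s(1))
    ultimately show ?thesis by blast
  qed
  have zero_rotation: "is_rotation \<phi>" if "b = 0"
    unfolding is_rotation_def
    by (rule exI[of _ "- u"]) (use that u form in \<open>simp add: mob_def\<close>)
  have involution_sym: ?sym if "involutive_automorphism \<phi>"
  proof (cases "b = 0")
    case True
    then show ?thesis by (intro rotation_sym zero_rotation)
  next
    case False
    have ub: "cmod (u * b) < 1" using u b by (simp add: norm_mult)
    \<comment> \<open>Involutivity tested at the single point 0 already forces
      \<open>u = 1\<close>.\<close>
    have "\<phi> (\<phi> 0) = 0" using that by (simp add: involutive_automorphism_def)
    then have "u * mob b (u * b) = 0" using form[of 0] form[OF ub] by simp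
    then have "b - u * b = 0"
      using u one_minus_cnj_mult_neq_0[OF b ub] by (auto simp: mob_def)
    then have "u = 1" using False by simp
    have T_comp: "T x = comp_mob b x" for x
      by (rule ev_inject) (simp add: T form ev_comp_mob b \<open>u = 1\<close>)
    obtain C where "antiunitary_involution C" "\<And>x. comp_mob b x = C (comp_mob_adj b (C x))"
      using comp_mob_symmetric[OF b False] by blast
    then show ?thesis unfolding T_comp using ip_comp_mob[OF b] by blast
  qed
  have necessity: "is_rotation \<phi> \<or> involutive_automorphism \<phi>"
    if C: "antiunitary_involution C" and S: "\<And>x y. ip (T x) y = ip x (S y)"
      and CS: "\<And>x. T x = C (S (C x))" for C S
  proof (cases "b = 0")
    case True
    then show ?thesis by (simp add: zero_rotation)
  next
    case False
    note CD = antiunitary_involutionD[OF C]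
    have "\<exists>r<1. \<forall>n. cmod ((\<phi> ^^ n) 0) \<le> r"
    proof (rule ccontr)
      assume "\<not> ?thesis"
      then have escape: "\<exists>n. r < cmod ((\<phi> ^^ n) 0)" if "r < 1" for r
        using that by (meson not_le)
      \<comment> \<open>\<open>ker 0\<close> is the constant function 1, which every composition
        operator fixes.\<close>
      have "T (ker 0) = ker 0"
        by (rule ev_inject) (simp add: T ev_ker_0 \<phi>_disk)
      then have "S (C (ker 0)) = C (ker 0)"
        using CD(4)[of "S (C (ker 0))"] by (simp flip: CS)
      then have "C (ker 0) = 0"
        by (intro adjoint_fixed_vector_zero[OF \<phi>_disk T _ escape]) (auto simp: S)
      then have "norm (ker 0) = 0" using CD(5)[of "ker 0"] by simp
      then show False using ev_ker_0[of 0] by (simp add: ev_def)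
    qed
    then obtain r where r: "r < 1" "\<And>n. cmod ((\<phi> ^^ n) 0) \<le> r" by blast
    obtain a where a: "cmod a < 1" "\<phi> a = a"
      by (rule disk_automorphism_fixpoint_or_escape[OF u b False form r])
    obtain l where l: "cmod l = 1" and \<phi>_eq: "\<And>z. cmod z < 1 \<Longrightarrow> \<phi> z = mob a (l * mob a z)"
    proof (rule disk_automorphism_fixpoint_form[OF assms a], goal_cases)
      case (1 l)
      show ?case by (rule 1(1)[of l]) (fact 1)+
    qed
    have "\<phi> 0 \<noteq> 0" using form[of 0] u False by auto
    then have "a \<noteq> 0" using a(2) by auto
    have "l\<^sup>2 = 1"
    proof (rule ccontr)
      assume "l\<^sup>2 \<noteq> 1"
      have "ev (T x) z = ev x (mob a (l * mob a z))" if "cmod z < 1" for x z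
        by (simp only: T[OF that] \<phi>_eq[OF that])
      then show False
        by (rule elliptic_not_symmetric[OF a(1) \<open>a \<noteq> 0\<close> l \<open>l\<^sup>2 \<noteq> 1\<close> _ C S CS])
    qed
    have "\<phi> (\<phi> z) = z" if z: "cmod z < 1" for z
    proof -
      have lm: "cmod (l * mob a z) < 1" using norm_mob[OF a(1) z] l by (simp add: norm_mult)
      have "\<phi> (\<phi> z) = mob a (l * mob a (mob a (l * mob a z)))"
        using \<phi>_eq[OF \<phi>_disk[OF z]] by (simp only: \<phi>_eq[OF z])
      also have "\<dots> = mob a (l\<^sup>2 * mob a z)"
        by (simp only: mob_mob[OF a(1) lm] power2_eq_square mult.assoc)
      finally show ?thesis using \<open>l\<^sup>2 = 1\<close> mob_mob[OF a(1) z] by simp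
    qed
    then have "involutive_automorphism \<phi>"
      using assms by (simp add: involutive_automorphism_def)
    then show ?thesis ..
  qed
  have "complex_symmetric hardy_space fun_scale hardy_inner (composition_operator \<phi>) \<longleftrightarrow> ?sym"
    by (rule complex_symmetric_composition_iff[OF _ bd]) (rule T)
  then show ?thesis
    using rotation_sym involution_sym necessity by blast
qed

end
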